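(* Let $\mathbf{k}$ be a field of characteristic zero, let $n,k\ge 1$ be integers, $\mathbf{m}=(m_1,\dots,m_n)\in\mathbb{Z}_{\ge 2}^n$, $R=\mathbf{k}[x_1,\dots,x_n]$, and $$I_{n,\mathbf{m},k}=\bigl(x_1^{m_1},\dots,x_n^{m_n},(x_1+\cdots+x_n)^k\bigr)\subseteq R .$$ For $1\le j\le n$ let $\mathrm{Crit}_{n,\mathbf{m},k,j}$ be the set of monomials defined in the context. For any monomial $s=x_1^{s_1}\cdots x_j^{s_j}=s'x_j^{s_j}\in\mathrm{Crit}_{n,\mathbf{m},k,j}$ (with $s'=x_1^{s_1}\cdots x_{j-1}^{s_{j-1}}$) define $$g_s=\sum_{s''\mid s'}\lambda_{s''}\,s''\,(x_j+\cdots+x_n)^{\deg(s)-\deg(s'')},\qquad \lambda_{s''}=\left(\prod_{i=1}^{j-1}\frac{s_i!}{s''_i!}\binom{m_i-s''_i-1}{s_i-s''_i}\right)\cdot\frac{s_j!}{(\deg(s)-\deg(s''))!},$$ where the sum runs over all monomials $s''=x_1^{s''_1}\cdots x_{j-1}^{s''_{j-1}}$ dividing $s'$, and where the monomials in the expansion of $(x_j+\cdots+x_n)^{\deg(s)-\deg(s'')}$ are reduced modulo $(x_j^{m_j},\dots,x_n^{m_n})$ if necessary, i.e. those lying in this ideal are deleted. Then the reduced Gröbner basis of $I_{n,\mathbf{m},k}$ with respect to any monomial ordering $\prec$ with $x_1\succ\cdots\succ x_n$ is $$G_{n,\mathbf{m},k}=\{x_1^{m_1},\dots,x_n^{m_n}\}\cup\bigcup_{j=1}^n\{g_s\mid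 s\in\mathrm{Crit}_{n,\mathbf{m},k,j}\},$$ where $x_j^{m_j}$ is removed if $k+\sum_{i=1}^{j-1}(m_i-1)<m_j$.
   Context: For a monomial $s=x_1^{s_1}\cdots x_n^{s_n}$, $\deg(s)=\sum_i s_i$, and $s$ is called $\mathbf{m}$-free if $s_i<m_i$ for all $i$. For $1\le j\le n$ put $s_{\le j}=x_1^{s_1}\cdots x_j^{s_j}$. Define $$\overline{\mathrm{Crit}}_{n,\mathbf{m},k,j}=\Bigl\{s\ \Big|\ s\text{ is an }\mathbf{m}\text{-free monomial of }R,\ x_j\mid s,\ s_j=2\deg(s_{\le j})-k-\sum_{i=1}^{j-1}m_i+(j-1)\Bigr\}$$ and $$\mathrm{Crit}_{n,\mathbf{m},k,j}=\left(\overline{\mathrm{Crit}}_{n,\mathbf{m},k,j}\setminus\bigcup_{\ell=1}^{j-1}\overline{\mathrm{Crit}}_{n,\mathbf{m},k,\ell}\right)\cap\mathbf{k}[x_1,\dots,x_j].$$ A monomial ordering is a total order on monomials, compatible with multiplication, with $1$ as least element. A Gröbner basis is reduced if its initial monomials minimally generate the initial ideal, each element has coefficient $1$ at its initial monomial, and no non-leading monomial of an element lies in the initial ideal.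
   Formalization: In Crit_{n,m,k,j}, all multiples of elements of the earlier sets CritBar_{n,m,k,l} (l<j) are removed, not only the elements themselves; as literally defined the claim fails, e.g. n=2, m=(5,5), k=1, where x_1^2 x_2 would be critical although x_1 is already an initial monomial. *)

theory Defs
  imports "HOL-Library.Poly_Mapping" "HOL-Algebra.Ideal"
begin

text \<open>
  A monomial is its finitely supported exponent vector, so the product of monomials is \<open>+\<close> and the
  monomial \<open>1\<close> is \<open>0\<close>. Polynomials are finitely supported coefficient functions on monomials, with
  the convolution product of \<open>Poly_Mapping\<close>. The type provides variables \<open>x\<^sub>i\<close> for all naturals
  \<open>i\<close>; the ring in \<open>x\<^sub>1, \<dots>, x\<^sub>n\<close> is singled out by a carrier.
\<close>

type_synonym mon = "nat \<Rightarrow>\<^sub>0 nat"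
type_synonym 'a mpol = "mon \<Rightarrow>\<^sub>0 'a"

definition monomials :: "nat \<Rightarrow> mon set" where
  "monomials n = {t. Poly_Mapping.keys t \<subseteq> {1..n}}"

definition poly_ring :: "nat \<Rightarrow> ('a::comm_ring_1) mpol ring" where
  "poly_ring n = \<lparr>carrier = {p. Poly_Mapping.keys p \<subseteq> monomials n}, monoid.mult = (*), one = 1, zero = 0, add = (+)\<rparr>"

lemma monomials_add: "s \<in> monomials n \<Longrightarrow> t \<in> monomials n \<Longrightarrow> s + t \<in> monomials n"
  unfolding monomials_def using Poly_Mapping.keys_add[of s t] by blast

lemma cring_poly_ring: "cring (poly_ring n :: ('a::comm_ring_1) mpol ring)"
proof (rule cringI)
  show "abelian_group (poly_ring n :: 'a mpol ring)"
  proof (rule abelian_groupI)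
    fix x y :: "'a mpol"
    assume "x \<in> carrier (poly_ring n)" "y \<in> carrier (poly_ring n)"
    then show "x \<oplus>\<^bsub>poly_ring n\<^esub> y \<in> carrier (poly_ring n)"
      using Poly_Mapping.keys_add[of x y] by (auto simp: poly_ring_def)
  next
    fix x :: "'a mpol"
    assume "x \<in> carrier (poly_ring n)"
    then show "\<exists>y\<in>carrier (poly_ring n). y \<oplus>\<^bsub>poly_ring n\<^esub> x = \<zero>\<^bsub>poly_ring n\<^esub>"
      by (intro bexI[of _ "- x"]) (auto simp: poly_ring_def)
  qed (auto simp: poly_ring_def algebra_simps)
  show "Group.comm_monoid (poly_ring n :: 'a mpol ring)"
  proof (rule comm_monoidI)
    fix x y :: "'a mpol"
    assume "x \<in> carrier (poly_ring n)" "y \<in> carrier (poly_ring n)"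
    then show "x \<otimes>\<^bsub>poly_ring n\<^esub> y \<in> carrier (poly_ring n)"
      using Poly_Mapping.keys_mult[of x y] monomials_add[of _ n] by (fastforce simp: poly_ring_def)
  qed (auto simp: poly_ring_def algebra_simps monomials_def)
qed (auto simp: poly_ring_def algebra_simps)


definition mon_poly :: "mon \<Rightarrow> ('a::comm_ring_1) mpol" where
  "mon_poly t = Poly_Mapping.single t 1"

definition X :: "nat \<Rightarrow> ('a::comm_ring_1) mpol" where
  "X i = mon_poly (Poly_Mapping.single i 1)"

definition mdeg :: "mon \<Rightarrow> nat" where
  "mdeg t = (\<Sum>i\<in>Poly_Mapping.keys t. Poly_Mapping.lookup t i)"

definition mdvd :: "mon \<Rightarrow> mon \<Rightarrow> bool" where
  "mdvd t s \<longleftrightarrow> (\<exists>u. s = t + u)"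

text \<open>\<open>trunc j s\<close> is \<open>s\<^bsub>\<le>j\<^esub>\<close>.\<close>

definition trunc :: "nat \<Rightarrow> mon \<Rightarrow> mon" where
  "trunc j s = (\<Sum>i=1..j. Poly_Mapping.single i (Poly_Mapping.lookup s i))"


text \<open>A monomial ordering is given as its non-strict order relation: \<open>(s, t) \<in> r\<close> means \<open>s \<preceq> t\<close>.\<close>

definition monomial_ordering :: "nat \<Rightarrow> mon rel \<Rightarrow> bool" where
  "monomial_ordering n r \<longleftrightarrow>
     linear_order_on (monomials n) r \<and>
     (\<forall>s\<in>monomials n. \<forall>t\<in>monomials n. \<forall>u\<in>monomials n. (s, t) \<in> r \<longrightarrow> (s + u, t + u) \<in> r) \<and>
     (\<forall>t\<in>monomials n. (0, t) \<in> r)"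

definition initial_monomial :: "mon rel \<Rightarrow> ('a::comm_ring_1) mpol \<Rightarrow> mon" where
  "initial_monomial r p = (THE t. t \<in> Poly_Mapping.keys p \<and> (\<forall>u\<in>Poly_Mapping.keys p. (u, t) \<in> r))"

definition initial_ideal :: "nat \<Rightarrow> mon rel \<Rightarrow> ('a::comm_ring_1) mpol set \<Rightarrow> 'a mpol set" where
  "initial_ideal n r I = Idl\<^bsub>poly_ring n\<^esub> {mon_poly (initial_monomial r p) | p. p \<in> I \<and> p \<noteq> 0}"

definition groebner_basis ::
    "nat \<Rightarrow> mon rel \<Rightarrow> ('a::comm_ring_1) mpol set \<Rightarrow> 'a mpol set \<Rightarrow> bool" where
  "groebner_basis n r I G \<longleftrightarrow>
     finite G \<and> G \<subseteq> I \<and> 0 \<notin> G \<and>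
     Idl\<^bsub>poly_ring n\<^esub> {mon_poly (initial_monomial r g) | g. g \<in> G} = initial_ideal n r I"

text \<open>
  Minimal generation is required of the family of initial monomials indexed by \<open>G\<close>, so distinct
  elements of \<open>G\<close> have distinct initial monomials.
\<close>

definition reduced_groebner_basis ::
    "nat \<Rightarrow> mon rel \<Rightarrow> ('a::comm_ring_1) mpol set \<Rightarrow> 'a mpol set \<Rightarrow> bool" where
  "reduced_groebner_basis n r I G \<longleftrightarrow>
     groebner_basis n r I G \<and>
     (\<forall>H. H \<subset> G \<longrightarrow>
        Idl\<^bsub>poly_ring n\<^esub> {mon_poly (initial_monomial r g) | g. g \<in> H} \<noteq> initial_ideal n r I) \<and>
     (\<forall>g\<in>G. Poly_Mapping.lookup g (initial_monomial r g) = 1) \<and>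
     (\<forall>g\<in>G. \<forall>t\<in>Poly_Mapping.keys g. t \<noteq> initial_monomial r g \<longrightarrow> mon_poly t \<notin> initial_ideal n r I)"


definition ideal_I :: "nat \<Rightarrow> (nat \<Rightarrow> nat) \<Rightarrow> nat \<Rightarrow> ('a::comm_ring_1) mpol set" where
  "ideal_I n m k = Idl\<^bsub>poly_ring n\<^esub> ({X i ^ m i | i. i \<in> {1..n}} \<union> {(\<Sum>i=1..n. X i) ^ k})"

definition m_free :: "nat \<Rightarrow> (nat \<Rightarrow> nat) \<Rightarrow> mon \<Rightarrow> bool" where
  "m_free n m s \<longleftrightarrow> (\<forall>i\<in>{1..n}. Poly_Mapping.lookup s i < m i)"

definition crit_bar :: "nat \<Rightarrow> (nat \<Rightarrow> nat) \<Rightarrow> nat \<Rightarrow> nat \<Rightarrow> mon set" where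
  "crit_bar n m k j =
     {s \<in> monomials n. m_free n m s \<and> mdvd (Poly_Mapping.single j 1) s \<and>
        int (Poly_Mapping.lookup s j) = 2 * int (mdeg (trunc j s)) - int k - (\<Sum>i=1..<j. int (m i)) + (int j - 1)}"

text \<open>
  The source removes from \<open>crit_bar n m k j\<close> only the elements of \<open>crit_bar n m k l\<close>, \<open>l < j\<close>; here
  their multiples are removed as well. Without this the set of the \<open>g\<^sub>s\<close> need not be a minimal
  Groebner basis: for \<open>n = 2\<close>, \<open>m = (5, 5)\<close>, \<open>k = 1\<close> the monomial \<open>x\<^sub>1\<^sup>2 x\<^sub>2\<close> lies in
  \<open>crit_bar n m k 2\<close> and not in \<open>crit_bar n m k 1\<close>, whereas the ideal contains \<open>x\<^sub>1 + x\<^sub>2\<close> and its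
  reduced Groebner basis is \<open>{x\<^sub>1 + x\<^sub>2, x\<^sub>2\<^sup>5}\<close>.
\<close>

definition crit :: "nat \<Rightarrow> (nat \<Rightarrow> nat) \<Rightarrow> nat \<Rightarrow> nat \<Rightarrow> mon set" where
  "crit n m k j =
     (crit_bar n m k j - (\<Union>l\<in>{1..<j}. {s. \<exists>t\<in>crit_bar n m k l. mdvd t s})) \<inter> monomials j"

definition delete_in :: "('a::comm_ring_1) mpol set \<Rightarrow> 'a mpol \<Rightarrow> 'a mpol" where
  "delete_in J p = (\<Sum>t | t \<in> Poly_Mapping.keys p \<and> mon_poly t \<notin> J. Poly_Mapping.single t (Poly_Mapping.lookup p t))"

text \<open>
  For \<open>t\<close> dividing the \<open>m\<close>-free monomial \<open>trunc (j - 1) s\<close>, none of the subtractions of naturals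
  below is truncated.
\<close>

definition lam :: "(nat \<Rightarrow> nat) \<Rightarrow> nat \<Rightarrow> mon \<Rightarrow> mon \<Rightarrow> 'a::field_char_0" where
  "lam m j s t =
     (\<Prod>i=1..<j. fact (Poly_Mapping.lookup s i) / fact (Poly_Mapping.lookup t i) *
        of_nat ((m i - Poly_Mapping.lookup t i - 1) choose (Poly_Mapping.lookup s i - Poly_Mapping.lookup t i)))
     * (fact (Poly_Mapping.lookup s j) / fact (mdeg s - mdeg t))"

definition g_poly :: "nat \<Rightarrow> (nat \<Rightarrow> nat) \<Rightarrow> nat \<Rightarrow> mon \<Rightarrow> ('a::field_char_0) mpol" where
  "g_poly n m j s =
     (\<Sum>t | mdvd t (trunc (j - 1) s).
        Poly_Mapping.single t (lam m j s t) *
        delete_in (Idl\<^bsub>poly_ring n\<^esub> {X i ^ m i | i. i \<in> {j..n}})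
          ((\<Sum>i=j..n. X i) ^ (mdeg s - mdeg t)))"

definition basis_G :: "nat \<Rightarrow> (nat \<Rightarrow> nat) \<Rightarrow> nat \<Rightarrow> ('a::field_char_0) mpol set" where
  "basis_G n m k =
     {X j ^ m j | j. j \<in> {1..n} \<and> \<not> k + (\<Sum>i=1..<j. (m i - 1)) < m j} \<union>
     (\<Union>j\<in>{1..n}. {g_poly n m j s | s. s \<in> crit n m k j})"

end

theory Submission
  imports Defs "HOL-Computational_Algebra.Formal_Power_Series"
begin

text \<open>
  Write \<open>K\<^sub>j = k + \<Sum>\<^bsub>i<j\<^esub> (m\<^sub>i - 1)\<close>. The defining equation of the critical monomials reads
  \<open>s\<^sub>j + 2 \<Sum>\<^bsub>i<j\<^esub> s\<^sub>i = K\<^sub>j\<close>, so that an \<open>m\<close>-free monomial \<open>s\<close> avoids all critical divisors iff the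
  quantities \<open>s\<^sub>j + 2 \<Sum>\<^bsub>i<j\<^esub> s\<^sub>i - K\<^sub>j\<close> are negative for all \<open>j\<close>; call such monomials standard.

  Membership of \<open>g\<^sub>s\<close> in the ideal: let \<open>P\<^sub>i(y)\<close> be the sum of
  \<open>s\<^sub>i! / b! * ((m\<^sub>i - b - 1) choose (s\<^sub>i - b))\<close> times \<open>y\<close> to the power \<open>b\<close> over \<open>b \<le> s\<^sub>i\<close>.
  Up to the factor \<open>s\<^sub>j!\<close>, \<open>g\<^sub>s\<close> is the coefficient of \<open>z\<close> to the power
  \<open>deg s\<close> in \<open>(\<Prod>\<^bsub>i<j\<^esub> P\<^sub>i(x\<^sub>i z)) exp ((x\<^sub>j + \<dots> + x\<^sub>n) z)\<close>, that is, in
  \<open>(\<Prod>\<^bsub>i<j\<^esub> P\<^sub>i(x\<^sub>i z) exp (- x\<^sub>i z)) exp ((x\<^sub>1 + \<dots> + x\<^sub>n) z)\<close>, where \<open>P\<^sub>i(y) exp (- y)\<close> modulo \<open>y\<close> to the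
  power \<open>m\<^sub>i\<close> has degree at most \<open>m\<^sub>i - 1 - s\<^sub>i\<close>. Modulo the powers of the variables, the product over
  \<open>i < j\<close> therefore has degree at most \<open>deg s - k\<close> in \<open>z\<close>, so that only terms with at least \<open>k\<close> factors
  \<open>x\<^sub>1 + \<dots> + x\<^sub>n\<close> remain.

  The monomials of \<open>g\<^sub>s\<close> other than \<open>s\<close> are smaller than \<open>s\<close> and standard. That no standard monomial is an
  initial monomial follows by counting: in degree \<open>d\<close> the ideal has, modulo the powers of the variables,
  dimension at most the number of \<open>m\<close>-free monomials of degree \<open>d - k\<close>, and if a standard monomial of degree
  \<open>d\<close> exists, then a reflection of lattice paths injects these into the nonstandard monomials of degree \<open>d\<close>,
  all of which are initial monomials.
\<close>

subsection \<open>Monomials and ideals\<close>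

abbreviation "keys \<equiv> Poly_Mapping.keys"
abbreviation "lookup \<equiv> Poly_Mapping.lookup"
abbreviation "single \<equiv> Poly_Mapping.single"

section \<open>Divisibility, degrees and truncation of monomials\<close>

lemma mdvd_iff: "mdvd t s \<longleftrightarrow> (\<forall>i. lookup t i \<le> lookup s i)"
proof
  assume "\<forall>i. lookup t i \<le> lookup s i"
  then have "s = t + (s - t)"
    by (intro poly_mapping_eqI) (simp add: lookup_add lookup_minus)
  then show "mdvd t s"
    unfolding mdvd_def by blast
qed (auto simp: mdvd_def lookup_add)

lemma mdvd_refl: "mdvd t t"
  by (simp add: mdvd_iff)

lemma mdvd_trans: "mdvd s t \<Longrightarrow> mdvd t u \<Longrightarrow> mdvd s u"
  unfolding mdvd_iff using order_trans by blast

lemma mdvd_antisym: "mdvd s t \<Longrightarrow> mdvd t s \<Longrightarrow> s = t"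
  unfolding mdvd_iff by (intro poly_mapping_eqI) (simp add: order_antisym)

lemma mdvd_add: "mdvd t (t + u)"
  by (auto simp: mdvd_def)

lemma lookup_monomials_eq_0: "t \<in> monomials n \<Longrightarrow> i \<notin> {1..n} \<Longrightarrow> lookup t i = 0"
  unfolding monomials_def using in_keys_iff[of i t] by blast

lemma monomialsI: "(\<And>i. i \<notin> {1..n} \<Longrightarrow> lookup t i = 0) \<Longrightarrow> t \<in> monomials n"
  by (metis (mono_tags, lifting) in_keys_iff mem_Collect_eq monomials_def subsetI)

lemma zero_in_monomials: "0 \<in> monomials n"
  by (simp add: monomials_def)

lemma single_in_monomials: "i \<in> {1..n} \<Longrightarrow> single i c \<in> monomials n"
  by (auto simp: monomials_def)

lemma mdvd_monomials: "mdvd t s \<Longrightarrow> s \<in> monomials n \<Longrightarrow> t \<in> monomials n"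
  by (rule monomialsI) (metis mdvd_iff le_zero_eq lookup_monomials_eq_0)

lemma monomials_mono: "j \<le> n \<Longrightarrow> monomials j \<subseteq> monomials n"
  by (force simp: monomials_def)

lemma finite_mdvd: "finite {t. mdvd t s}"
proof (rule finite_subset)
  show "{t. mdvd t s} \<subseteq> (\<lambda>f. \<Sum>i\<in>keys s. single i (f i)) ` (\<Pi>\<^sub>E i\<in>keys s. {..lookup s i})"
  proof
    fix t assume "t \<in> {t. mdvd t s}"
    then have le: "lookup t i \<le> lookup s i" for i
      by (simp add: mdvd_iff)
    have "t = (\<Sum>i\<in>keys s. single i (restrict (lookup t) (keys s) i))"
    proof (rule poly_mapping_eqI)
      fix i
      show "lookup t i = lookup (\<Sum>i\<in>keys s. single i (restrict (lookup t) (keys s) i)) i"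
        using le[of i] by (auto simp: lookup_sum lookup_single when_def in_keys_iff)
    qed
    moreover have "restrict (lookup t) (keys s) \<in> (\<Pi>\<^sub>E i\<in>keys s. {..lookup s i})"
      using le by auto
    ultimately show "t \<in> (\<lambda>f. \<Sum>i\<in>keys s. single i (f i)) ` (\<Pi>\<^sub>E i\<in>keys s. {..lookup s i})"
      by blast
  qed
qed (intro finite_imageI finite_PiE; simp)

lemma mdeg_eq_sum: "t \<in> monomials n \<Longrightarrow> mdeg t = (\<Sum>i=1..n. lookup t i)"
  unfolding mdeg_def
  by (rule sum.mono_neutral_left) (auto simp: monomials_def in_keys_iff)

lemma mdeg_zero [simp]: "mdeg 0 = 0"
  by (simp add: mdeg_def)

lemma mdeg_single [simp]: "mdeg (single i c) = c"
  by (simp add: mdeg_def)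

lemma mdeg_add: "mdeg (s + t) = mdeg s + mdeg t"
proof -
  have "mdeg u = (\<Sum>i\<in>keys s \<union> keys t. lookup u i)" if "keys u \<subseteq> keys s \<union> keys t" for u :: mon
    unfolding mdeg_def using that by (intro sum.mono_neutral_left) (auto simp: in_keys_iff)
  from this[of "s + t"] this[of s] this[of t] show ?thesis
    using Poly_Mapping.keys_add[of s t] by (simp add: lookup_add sum.distrib)
qed

lemma mdeg_le: "mdvd t s \<Longrightarrow> mdeg t \<le> mdeg s"
  by (auto simp: mdvd_def mdeg_add)

lemma mdeg_eq_0_iff: "mdeg t = 0 \<longleftrightarrow> t = 0"
  by (auto simp: mdeg_def in_keys_iff intro: poly_mapping_eqI)

lemma mdvd_mdeg_eq: "mdvd s t \<Longrightarrow> mdeg t \<le> mdeg s \<Longrightarrow> s = t"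
  by (auto simp: mdvd_def mdeg_add mdeg_eq_0_iff)

lemma single_mdvd_iff: "mdvd (single i c) t \<longleftrightarrow> c \<le> lookup t i"
  by (auto simp: mdvd_iff lookup_single when_def)

lemma lookup_trunc: "lookup (trunc j s) i = (if i \<in> {1..j} then lookup s i else 0)"
  by (simp add: trunc_def lookup_sum lookup_single when_def)

lemma trunc_in_monomials: "trunc j s \<in> monomials j"
  by (rule monomialsI) (simp add: lookup_trunc del: atLeastAtMost_iff)

lemma mdeg_trunc: "mdeg (trunc j s) = (\<Sum>i=1..j. lookup s i)"
  using mdeg_eq_sum[OF trunc_in_monomials, of j s] by (simp add: lookup_trunc)

section \<open>Supports of polynomials\<close>

lemma poly_eq_sum: "p = (\<Sum>t\<in>keys p. single t (lookup p t))"
  by (rule poly_mapping_eqI)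
    (auto simp: lookup_sum lookup_single when_def sum.delta in_keys_iff)

lemma keys_uminus: "keys (- p) = keys (p :: ('a::comm_ring_1) mpol)"
  by (auto simp: in_keys_iff)

lemma single_mult_eq_sum:
  fixes p :: "('a::comm_ring_1) mpol"
  shows "single u c * p = (\<Sum>t\<in>keys p. single (u + t) (c * lookup p t))"
  by (subst poly_eq_sum[of p]) (simp add: sum_distrib_left mult_single)

lemma keys_sum_subset: "keys (sum f S) \<subseteq> (\<Union>x\<in>S. keys (f x))"
proof
  fix t assume "t \<in> keys (sum f S)"
  then have "(\<Sum>x\<in>S. lookup (f x) t) \<noteq> 0"
    by (simp add: in_keys_iff lookup_sum)
  then show "t \<in> (\<Union>x\<in>S. keys (f x))"
    by (metis UN_I in_keys_iff sum.not_neutral_contains_not_neutral)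
qed

lemma lookup_single_mult:
  fixes p :: "('a::comm_ring_1) mpol"
  shows "lookup (single u c * p) (u + t) = c * lookup p t"
  unfolding single_mult_eq_sum lookup_sum lookup_single when_def
  by (auto simp: in_keys_iff)

lemma keys_single_mult:
  fixes p :: "('a::comm_ring_1) mpol"
  shows "keys (single u c * p) \<subseteq> (+) u ` keys p"
  using keys_mult[of "single u c" p] by (auto split: if_splits)

lemma keys_mult_monomials:
  fixes p q :: "('a::comm_ring_1) mpol"
  assumes "keys p \<subseteq> monomials n" "keys q \<subseteq> monomials n"
  shows "keys (p * q) \<subseteq> monomials n"
  using keys_mult[of p q] monomials_add[of _ n] assms by blast

lemma keys_add_monomials:
  assumes "keys p \<subseteq> monomials n" "keys q \<subseteq> monomials n"
  shows "keys (p + q) \<subseteq> monomials n"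
  using Poly_Mapping.keys_add[of p q] assms by blast

lemma keys_power_monomials:
  fixes p :: "('a::comm_ring_1) mpol"
  assumes "keys p \<subseteq> monomials n"
  shows "keys (p ^ e) \<subseteq> monomials n"
  by (induction e) (simp_all add: zero_in_monomials keys_mult_monomials assms)

lemma keys_sum_monomials:
  assumes "\<And>x. x \<in> S \<Longrightarrow> keys (f x) \<subseteq> monomials n"
  shows "keys (sum f S) \<subseteq> monomials n"
  using keys_sum_subset[of f S] assms by blast

lemma keys_mon_poly [simp]: "keys (mon_poly t :: ('a::comm_ring_1) mpol) = {t}"
  by (simp add: mon_poly_def)

lemma keys_X_monomials: "i \<in> {1..n} \<Longrightarrow> keys (X i :: ('a::comm_ring_1) mpol) \<subseteq> monomials n"
  by (simp add: X_def single_in_monomials)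

lemma X_power: "X i ^ e = mon_poly (single i e)"
  unfolding X_def mon_poly_def
  by (induction e) (simp_all add: mult_single flip: single_add)

section \<open>Ideals of \<open>poly_ring n\<close>\<close>

lemma carrier_poly_ring: "p \<in> carrier (poly_ring n) \<longleftrightarrow> keys p \<subseteq> monomials n"
  by (simp add: poly_ring_def)

text \<open>Restates ideals of the record \<open>poly_ring n\<close> with the type class operations.
  Additive inverses come from multiplication by \<open>- 1\<close>, so closure under negation does
  not appear on the right.\<close>

lemma ideal_poly_ring_iff:
  fixes J :: "('a::comm_ring_1) mpol set"
  shows "ideal J (poly_ring n) \<longleftrightarrow>
    J \<subseteq> carrier (poly_ring n) \<and> 0 \<in> J \<and> (\<forall>p\<in>J. \<forall>q\<in>J. p + q \<in> J) \<and>
    (\<forall>a. \<forall>p\<in>J. keys a \<subseteq> monomials n \<longrightarrow> a * p \<in> J)"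
    (is "_ \<longleftrightarrow> ?R")
proof
  assume "ideal J (poly_ring n)"
  then interpret ideal J "poly_ring n" .
  show ?R
    using a_subset additive_subgroup.zero_closed[OF is_additive_subgroup]
      additive_subgroup.a_closed[OF is_additive_subgroup] I_l_closed
    by (auto simp: poly_ring_def)
next
  assume R: ?R
  interpret cring "poly_ring n :: 'a mpol ring"
    by (rule cring_poly_ring)
  have minus: "\<ominus>\<^bsub>poly_ring n\<^esub> p = - p" if "p \<in> carrier (poly_ring n)" for p :: "'a mpol"
    using that by (intro minus_equality) (auto simp: poly_ring_def)
  have neg: "- p \<in> J" if "p \<in> J" for p
  proof -
    have "keys (- 1 :: 'a mpol) \<subseteq> monomials n"
      by (simp add: keys_uminus zero_in_monomials)
    with R that have "- 1 * p \<in> J"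
      by blast
    then show ?thesis
      by simp
  qed
  have R': "p * a \<in> J" if "p \<in> J" "keys a \<subseteq> monomials n" for p a
    using R that by (simp add: mult.commute)
  show "ideal J (poly_ring n)"
  proof (rule idealI)
    show "subgroup J (add_monoid (poly_ring n))"
      using R neg minus
      by (intro subgroup.intro) (auto simp: poly_ring_def minus[unfolded a_inv_def poly_ring_def, simplified])
  qed (use R R' cring.axioms(1)[OF cring_poly_ring, of n] in \<open>auto simp: poly_ring_def\<close>)
qed

lemma ideal_Idl:
  fixes S :: "('a::comm_ring_1) mpol set"
  assumes "S \<subseteq> carrier (poly_ring n)"
  shows "ideal (Idl\<^bsub>poly_ring n\<^esub> S) (poly_ring n)"
  using assms cring_poly_ring cring.axioms(1) ring.genideal_ideal by blast

lemma Idl_self: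
  fixes S :: "('a::comm_ring_1) mpol set"
  assumes "S \<subseteq> carrier (poly_ring n)"
  shows "S \<subseteq> Idl\<^bsub>poly_ring n\<^esub> S"
  using assms cring_poly_ring cring.axioms(1) ring.genideal_self by blast

lemma Idl_minimal:
  fixes S :: "('a::comm_ring_1) mpol set"
  assumes "ideal J (poly_ring n)" "S \<subseteq> J"
  shows "Idl\<^bsub>poly_ring n\<^esub> S \<subseteq> J"
  using assms cring_poly_ring cring.axioms(1) ring.genideal_minimal by blast

lemma
  fixes J :: "('a::comm_ring_1) mpol set"
  assumes "ideal J (poly_ring n)"
  shows ideal_zero_closed: "0 \<in> J"
    and ideal_add_closed: "p \<in> J \<Longrightarrow> q \<in> J \<Longrightarrow> p + q \<in> J"
    and ideal_mult_closed: "keys a \<subseteq> monomials n \<Longrightarrow> p \<in> J \<Longrightarrow> a * p \<in> J"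
  using assms unfolding ideal_poly_ring_iff by blast+

lemma ideal_sum_closed:
  fixes J :: "('a::comm_ring_1) mpol set"
  assumes "ideal J (poly_ring n)" "\<And>x. x \<in> S \<Longrightarrow> f x \<in> J"
  shows "sum f S \<in> J"
  using assms(2)
  by (induction S rule: infinite_finite_induct)
    (use assms(1) in \<open>auto simp: ideal_poly_ring_iff\<close>)

text \<open>The right-hand side is an ideal containing the generators; conversely, each of its
  elements is the sum of its terms, and each term is a multiple of a generator. Membership in a
  monomial ideal thus depends on the support alone.\<close>

lemma Idl_mon_poly:
  assumes "T \<subseteq> monomials n"
  shows "Idl\<^bsub>poly_ring n\<^esub> (mon_poly ` T :: ('a::comm_ring_1) mpol set)
    = {p. keys p \<subseteq> monomials n \<and> (\<forall>t\<in>keys p. \<exists>u\<in>T. mdvd u t)}" (is "?I = ?J")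
proof
  have sub: "mon_poly ` T \<subseteq> carrier (poly_ring n :: 'a mpol ring)"
    using assms by (auto simp: carrier_poly_ring)
  have "ideal ?J (poly_ring n)"
    unfolding ideal_poly_ring_iff
  proof (intro conjI allI ballI impI)
    fix p q :: "'a mpol" assume "p \<in> ?J" "q \<in> ?J"
    then show "p + q \<in> ?J"
      using Poly_Mapping.keys_add[of p q] by blast
  next
    fix a p :: "'a mpol" assume p: "p \<in> ?J" and a: "keys a \<subseteq> monomials n"
    have "\<exists>u\<in>T. mdvd u t" if "t \<in> keys (a * p)" for t
    proof -
      from that obtain v w where "t = v + w" "w \<in> keys p"
        using keys_mult[of a p] by blast
      then show ?thesis
        using p mdvd_trans[OF _ mdvd_add[of w v]] by (fastforce simp: add.commute)
    qed
    then show "a * p \<in> ?J"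
      using p a keys_mult_monomials by blast
  qed (auto simp: carrier_poly_ring)
  then show "?I \<subseteq> ?J"
    by (rule Idl_minimal) (use assms mdvd_refl in force)
  show "?J \<subseteq> ?I"
  proof
    fix p assume p: "p \<in> ?J"
    have "(\<Sum>t\<in>keys p. single t (lookup p t)) \<in> ?I"
    proof (rule ideal_sum_closed[OF ideal_Idl[OF sub]])
      fix t assume t: "t \<in> keys p"
      with p obtain u v where u: "u \<in> T" "t = u + v"
        by (auto simp: mdvd_def)
      then have "v \<in> monomials n"
        using p t mdvd_monomials[of v t n] mdvd_add[of v u] by (auto simp: add.commute)
      then have "keys (single v (lookup p t)) \<subseteq> monomials n"
        by simp
      moreover have "mon_poly u \<in> ?I"
        using Idl_self[OF sub] u by blast
      ultimately have "single v (lookup p t) * mon_poly u \<in> ?I"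
        using ideal_Idl[OF sub] by (auto simp: ideal_poly_ring_iff)
      then show "single t (lookup p t) \<in> ?I"
        by (simp add: mon_poly_def mult_single u add.commute)
    qed
    then show "p \<in> ?I"
      by (simp flip: poly_eq_sum)
  qed
qed

subsection \<open>Reduced Groebner bases\<close>

locale mon_order =
  fixes n :: nat and r :: "mon rel"
  assumes monomial_ordering: "monomial_ordering n r"
begin

lemma le_refl: "t \<in> monomials n \<Longrightarrow> (t, t) \<in> r"
  using monomial_ordering
  by (auto simp: monomial_ordering_def order_on_defs refl_on_def)

lemma le_trans: "(s, t) \<in> r \<Longrightarrow> (t, u) \<in> r \<Longrightarrow> (s, u) \<in> r"
  using monomial_ordering
  by (auto simp: monomial_ordering_def order_on_defs dest: transD)

lemma le_antisym: "(s, t) \<in> r \<Longrightarrow> (t, s) \<in> r \<Longrightarrow> s = t"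
  using monomial_ordering
  by (auto simp: monomial_ordering_def order_on_defs dest: antisymD)

lemma le_total: "s \<in> monomials n \<Longrightarrow> t \<in> monomials n \<Longrightarrow> (s, t) \<in> r \<or> (t, s) \<in> r"
  using monomial_ordering le_refl
  by (cases "s = t") (auto simp: monomial_ordering_def order_on_defs total_on_def)

lemma le_add:
  assumes "(s, t) \<in> r" "u \<in> monomials n"
  shows "(s + u, t + u) \<in> r"
proof -
  have "r \<subseteq> monomials n \<times> monomials n"
    using monomial_ordering by (auto simp: monomial_ordering_def order_on_defs)
  then show ?thesis
    using monomial_ordering assms by (auto simp: monomial_ordering_def)
qed

lemma ex_greatest:
  assumes "finite S" "S \<noteq> {}" "S \<subseteq> monomials n"
  shows "\<exists>t\<in>S. \<forall>u\<in>S. (u, t) \<in> r"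
  using assms
proof (induction rule: finite_ne_induct)
  case (singleton x)
  then show ?case
    using le_refl by simp
next
  case (insert x F)
  then obtain t where t: "t \<in> F" "\<forall>u\<in>F. (u, t) \<in> r"
    by auto
  have "x \<in> monomials n" "t \<in> monomials n"
    using insert.prems t by auto
  then consider "(x, t) \<in> r" | "(t, x) \<in> r"
    using le_total by blast
  then show ?case
  proof cases
    case 1
    with t show ?thesis
      by blast
  next
    case 2
    with t le_trans le_refl[OF \<open>x \<in> monomials n\<close>] show ?thesis
      by blast
  qed
qed

lemma initial_monomial_eqI:
  assumes "t \<in> keys p" "\<And>u. u \<in> keys p \<Longrightarrow> (u, t) \<in> r"
  shows "initial_monomial r p = t"
  unfolding initial_monomial_def
  by (rule the_equality) (use assms le_antisym in auto)

lemma initial_monomial: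
  assumes "p \<noteq> 0" "keys p \<subseteq> monomials n"
  shows initial_monomial_in_keys: "initial_monomial r p \<in> keys p"
    and initial_monomial_greatest: "u \<in> keys p \<Longrightarrow> (u, initial_monomial r p) \<in> r"
proof -
  have "keys p \<noteq> {}"
    using assms(1) by (metis keys_eq_empty)
  then obtain t where t: "t \<in> keys p" "\<And>u. u \<in> keys p \<Longrightarrow> (u, t) \<in> r"
    using ex_greatest assms by (metis finite_keys)
  from initial_monomial_eqI[OF this] t
  show "initial_monomial r p \<in> keys p" "u \<in> keys p \<Longrightarrow> (u, initial_monomial r p) \<in> r"
    by auto
qed

lemma initial_monomial_in_monomials:
  assumes "p \<in> S" "S \<subseteq> carrier (poly_ring n)" "0 \<notin> S"
  shows "initial_monomial r p \<in> monomials n"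
proof -
  have "p \<noteq> 0" "keys p \<subseteq> monomials n"
    using assms by (auto simp flip: carrier_poly_ring)
  then show ?thesis
    using initial_monomial_in_keys by blast
qed

lemma Idl_initial_monomials:
  fixes S :: "('a::comm_ring_1) mpol set"
  assumes "S \<subseteq> carrier (poly_ring n)" "0 \<notin> S"
  shows "Idl\<^bsub>poly_ring n\<^esub> {mon_poly (initial_monomial r p) | p. p \<in> S}
    = {p :: 'a mpol. keys p \<subseteq> monomials n \<and> (\<forall>t\<in>keys p. \<exists>g\<in>S. mdvd (initial_monomial r g) t)}"
proof -
  have "initial_monomial r ` S \<subseteq> monomials n"
    using assms initial_monomial_in_monomials by auto
  from Idl_mon_poly[OF this, where 'a = 'a] show ?thesis
    by (simp add: setcompr_eq_image image_image)
qed

lemma mon_poly_in_Idl_initial_iff: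
  fixes S :: "('a::comm_ring_1) mpol set"
  assumes "S \<subseteq> carrier (poly_ring n)" "0 \<notin> S" "t \<in> monomials n"
  shows "(mon_poly t :: 'a mpol) \<in> Idl\<^bsub>poly_ring n\<^esub> {mon_poly (initial_monomial r p) | p. p \<in> S}
    \<longleftrightarrow> (\<exists>g\<in>S. mdvd (initial_monomial r g) t)"
  unfolding Idl_initial_monomials[OF assms(1,2)] using assms(3) by simp

text \<open>Equality of these monomial ideals reduces to divisibility between generators. With
  \<open>T = I - {0}\<close> this expresses the Groebner property, with \<open>T = G\<close>
  minimality.\<close>

lemma Idl_initial_eq_iff:
  fixes S T :: "('a::comm_ring_1) mpol set"
  assumes "T \<subseteq> carrier (poly_ring n)" "0 \<notin> T" "S \<subseteq> T"
  shows "Idl\<^bsub>poly_ring n\<^esub> {mon_poly (initial_monomial r p) | p. p \<in> S}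
      = Idl\<^bsub>poly_ring n\<^esub> {mon_poly (initial_monomial r p) :: 'a mpol | p. p \<in> T}
    \<longleftrightarrow> (\<forall>p\<in>T. \<exists>g\<in>S. mdvd (initial_monomial r g) (initial_monomial r p))" (is "?I S = ?I T \<longleftrightarrow> ?R")
proof
  have S: "S \<subseteq> carrier (poly_ring n)" "0 \<notin> S"
    using assms by auto
  { assume eq: "?I S = ?I T"
    show ?R
    proof
      fix p assume p: "p \<in> T"
      then have t: "initial_monomial r p \<in> monomials n"
        using assms initial_monomial_in_monomials by auto
      have "mon_poly (initial_monomial r p) \<in> ?I T"
        unfolding mon_poly_in_Idl_initial_iff[OF assms(1,2) t] using p mdvd_refl by blast
      then show "\<exists>g\<in>S. mdvd (initial_monomial r g) (initial_monomial r p)"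
        unfolding eq[symmetric] mon_poly_in_Idl_initial_iff[OF S t] .
    qed }
  { assume ?R
    then show "?I S = ?I T"
      unfolding Idl_initial_monomials[OF assms(1,2)] Idl_initial_monomials[OF S]
      using assms(3) by (meson mdvd_trans subsetD) }
qed

lemma groebner_basis_iff:
  fixes I :: "('a::comm_ring_1) mpol set"
  assumes "I \<subseteq> carrier (poly_ring n)"
  shows "groebner_basis n r I G \<longleftrightarrow> finite G \<and> G \<subseteq> I \<and> 0 \<notin> G \<and>
    (\<forall>p\<in>I. p \<noteq> 0 \<longrightarrow> (\<exists>g\<in>G. mdvd (initial_monomial r g) (initial_monomial r p)))"
proof (cases "G \<subseteq> I \<and> 0 \<notin> G")
  case True
  have "{mon_poly (initial_monomial r p) |p. p \<in> I \<and> p \<noteq> 0}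
      = {mon_poly (initial_monomial r p) :: 'a mpol |p. p \<in> I - {0}}"
    by auto
  then have "Idl\<^bsub>poly_ring n\<^esub> {mon_poly (initial_monomial r g) | g. g \<in> G} = initial_ideal n r I \<longleftrightarrow>
      (\<forall>p\<in>I - {0}. \<exists>g\<in>G. mdvd (initial_monomial r g) (initial_monomial r p))"
    unfolding initial_ideal_def using Idl_initial_eq_iff[of "I - {0}" G] assms True by auto
  then show ?thesis
    using True by (auto simp: groebner_basis_def)
qed (auto simp: groebner_basis_def)

lemma reduced_groebner_basis_iff:
  fixes I :: "('a::comm_ring_1) mpol set"
  assumes "I \<subseteq> carrier (poly_ring n)"
  shows "reduced_groebner_basis n r I G \<longleftrightarrow> finite G \<and> G \<subseteq> I \<and> 0 \<notin> G \<and>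
    (\<forall>p\<in>I. p \<noteq> 0 \<longrightarrow> (\<exists>g\<in>G. mdvd (initial_monomial r g) (initial_monomial r p))) \<and>
    (\<forall>g\<in>G. \<forall>h\<in>G. g \<noteq> h \<longrightarrow> \<not> mdvd (initial_monomial r g) (initial_monomial r h)) \<and>
    (\<forall>g\<in>G. lookup g (initial_monomial r g) = 1) \<and>
    (\<forall>g\<in>G. \<forall>t\<in>keys g. t \<noteq> initial_monomial r g \<longrightarrow> (\<forall>h\<in>G. \<not> mdvd (initial_monomial r h) t))"
proof (cases "groebner_basis n r I G")
  case True
  then have G: "G \<subseteq> carrier (poly_ring n)" "0 \<notin> G"
    and eq: "initial_ideal n r I = Idl\<^bsub>poly_ring n\<^esub> {mon_poly (initial_monomial r g) | g. g \<in> G}"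
    using assms by (auto simp: groebner_basis_def)
  have "(\<forall>H. H \<subset> G \<longrightarrow>
      Idl\<^bsub>poly_ring n\<^esub> {mon_poly (initial_monomial r g) | g. g \<in> H} \<noteq> initial_ideal n r I)
      \<longleftrightarrow> (\<forall>H. H \<subset> G \<longrightarrow> (\<exists>p\<in>G. \<forall>g\<in>H. \<not> mdvd (initial_monomial r g) (initial_monomial r p)))"
    by (rule all_cong) (simp add: eq Idl_initial_eq_iff[OF G] psubset_imp_subset)
  also have "\<dots> \<longleftrightarrow>
      (\<forall>g\<in>G. \<forall>h\<in>G. g \<noteq> h \<longrightarrow> \<not> mdvd (initial_monomial r g) (initial_monomial r h))" (is "?L = ?R")
  proof
    assume L: ?L
    show ?R
    proof (intro ballI impI notI)
      fix g h assume gh: "g \<in> G" "h \<in> G" "g \<noteq> h" "mdvd (initial_monomial r g) (initial_monomial r h)"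
      \<comment> \<open>Removing \<open>h\<close> alone suffices: the element left without a divisor
        must be \<open>h\<close> itself, yet the initial monomial of \<open>g\<close> still divides
        that of \<open>h\<close>.\<close>
      have "G - {h} \<subset> G"
        using gh by auto
      from L[rule_format, OF this] obtain p where p: "p \<in> G"
        "\<And>f. f \<in> G - {h} \<Longrightarrow> \<not> mdvd (initial_monomial r f) (initial_monomial r p)"
        by auto
      have "p = h"
        using p(2)[of p] p(1) mdvd_refl by blast
      then show False
        using p(2)[of g] gh by blast
    qed
  next
    assume ?R
    then show ?L
      by (metis (no_types) psubset_imp_ex_mem DiffD1 DiffD2 psubsetD)
  qed
  finally have min: "(\<forall>H. H \<subset> G \<longrightarrow>
      Idl\<^bsub>poly_ring n\<^esub> {mon_poly (initial_monomial r g) | g. g \<in> H} \<noteq> initial_ideal n r I)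
      \<longleftrightarrow> (\<forall>g\<in>G. \<forall>h\<in>G. g \<noteq> h \<longrightarrow> \<not> mdvd (initial_monomial r g) (initial_monomial r h))" .
  have "mon_poly t \<notin> initial_ideal n r I \<longleftrightarrow> (\<forall>h\<in>G. \<not> mdvd (initial_monomial r h) t)"
    if "g \<in> G" "t \<in> keys g" for g t
  proof -
    have "t \<in> monomials n"
      using that G carrier_poly_ring by blast
    then show ?thesis
      unfolding eq by (simp add: mon_poly_in_Idl_initial_iff[OF G])
  qed
  then have red: "(\<forall>g\<in>G. \<forall>t\<in>keys g. t \<noteq> initial_monomial r g \<longrightarrow> mon_poly t \<notin> initial_ideal n r I) \<longleftrightarrow>
      (\<forall>g\<in>G. \<forall>t\<in>keys g. t \<noteq> initial_monomial r g \<longrightarrow> (\<forall>h\<in>G. \<not> mdvd (initial_monomial r h) t))"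
    by blast
  show ?thesis
    unfolding reduced_groebner_basis_def min red
    unfolding groebner_basis_iff[OF assms] by (simp only: conj_assoc)
next
  case False
  then show ?thesis
    unfolding reduced_groebner_basis_def groebner_basis_iff[OF assms] by blast
qed

text \<open>Each \<open>g\<close> is matched with an \<open>h\<close> having the same initial
  monomial. In \<open>g - h\<close> the leading coefficients 1 cancel, so if the difference were
  nonzero, its initial monomial would be a non-leading monomial of \<open>g\<close> or
  \<open>h\<close> lying in the initial ideal.\<close>

lemma reduced_groebner_basis_subset:
  fixes I :: "('a::comm_ring_1) mpol set"
  assumes I: "ideal I (poly_ring n)"
    and G: "reduced_groebner_basis n r I G" and H: "reduced_groebner_basis n r I H"
  shows "G \<subseteq> H"
proof
  have sub: "I \<subseteq> carrier (poly_ring n)"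
    using I by (auto simp: ideal_poly_ring_iff)
  note G = G[unfolded reduced_groebner_basis_iff[OF sub]]
  note H = H[unfolded reduced_groebner_basis_iff[OF sub]]
  fix g assume g: "g \<in> G"
  have "g \<in> I" "g \<noteq> 0"
    using G g by auto
  with H obtain h where h: "h \<in> H" "mdvd (initial_monomial r h) (initial_monomial r g)"
    by meson
  have "h \<in> I" "h \<noteq> 0"
    using H h by auto
  with G obtain g' where g': "g' \<in> G" "mdvd (initial_monomial r g') (initial_monomial r h)"
    by meson
  \<comment> \<open>The initial monomials divide each other in the order \<open>g'\<close>,
    \<open>h\<close>, \<open>g\<close>; minimality of \<open>G\<close> closes the chain.\<close>
  then have "g' = g"
    using G g h mdvd_trans by meson
  then have eq: "initial_monomial r h = initial_monomial r g"
    using g' h mdvd_antisym by blast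
  have "g - h = 0"
  proof (rule ccontr)
    assume nz: "g - h \<noteq> 0"
    have "keys (- 1 :: 'a mpol) \<subseteq> monomials n"
      by (simp add: keys_uminus zero_in_monomials)
    then have "- 1 * h \<in> I"
      using I \<open>h \<in> I\<close> unfolding ideal_poly_ring_iff by blast
    then have "g + - 1 * h \<in> I"
      using I \<open>g \<in> I\<close> by (auto simp: ideal_poly_ring_iff)
    then have dI: "g - h \<in> I"
      by simp
    then have "keys (g - h) \<subseteq> monomials n"
      using sub carrier_poly_ring by blast
    from initial_monomial_in_keys[OF nz this]
    have t: "initial_monomial r (g - h) \<in> keys (g - h)" (is "?t \<in> _") .
    have "lookup (g - h) (initial_monomial r g) = 0"
      using G H g h eq by (metis lookup_minus diff_self)
    then have ne: "?t \<noteq> initial_monomial r g"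
      using t by (metis in_keys_iff)
    have "?t \<in> keys g \<or> ?t \<in> keys h"
      using t by (auto simp: in_keys_iff lookup_minus)
    then show False
    proof
      assume "?t \<in> keys g"
      moreover obtain a where "a \<in> G" "mdvd (initial_monomial r a) ?t"
        using G dI nz by meson
      ultimately show False
        using G g ne by blast
    next
      assume "?t \<in> keys h"
      moreover obtain a where "a \<in> H" "mdvd (initial_monomial r a) ?t"
        using H dI nz by meson
      ultimately show False
        using H h ne eq by metis
    qed
  qed
  then show "g \<in> H"
    using h by simp
qed

lemma reduced_groebner_basis_unique:
  fixes I :: "('a::comm_ring_1) mpol set"
  assumes "ideal I (poly_ring n)" "reduced_groebner_basis n r I G"
  shows "reduced_groebner_basis n r I H \<longleftrightarrow> H = G"
  using assms reduced_groebner_basis_subset by blast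

end

subsection \<open>Critical monomials and lattice paths\<close>

definition m_free_mons :: "nat \<Rightarrow> (nat \<Rightarrow> nat) \<Rightarrow> nat \<Rightarrow> mon set" where
  "m_free_mons n m d = {s \<in> monomials n. m_free n m s \<and> mdeg s = d}"

lemma finite_m_free: "finite {s \<in> monomials n. m_free n m s}"
proof (rule finite_subset)
  show "{s \<in> monomials n. m_free n m s} \<subseteq> {t. mdvd t (\<Sum>i=1..n. single i (m i))}"
  proof
    fix t assume "t \<in> {s \<in> monomials n. m_free n m s}"
    then have t: "t \<in> monomials n" "\<And>i. i \<in> {1..n} \<Longrightarrow> lookup t i < m i"
      by (auto simp: m_free_def)
    have "lookup t i \<le> lookup (\<Sum>i=1..n. single i (m i)) i" for i
      using t(2)[of i] lookup_monomials_eq_0[OF t(1), of i]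
      by (auto simp: lookup_sum lookup_single when_def)
    then show "t \<in> {t. mdvd t (\<Sum>i=1..n. single i (m i))}"
      by (simp add: mdvd_iff)
  qed
qed (rule finite_mdvd)

lemma finite_m_free_mons: "finite (m_free_mons n m d)"
  by (rule finite_subset[OF _ finite_m_free[of n m]]) (auto simp: m_free_mons_def)

lemma m_free_mdvd: "m_free n m s \<Longrightarrow> mdvd t s \<Longrightarrow> m_free n m t"
  by (auto simp: m_free_def mdvd_iff intro: le_less_trans)

locale ci =
  fixes n k :: nat and m :: "nat \<Rightarrow> nat"
  assumes k_pos: "k \<ge> 1" and m_ge_2: "\<And>i. i \<in> {1..n} \<Longrightarrow> m i \<ge> 2"
begin

text \<open>A monomial \<open>s\<close> corresponds to the lattice path that starts at level \<open>- k\<close> and makes, for each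
  \<open>i\<close> in turn, \<open>s\<^sub>i\<close> steps up and \<open>m\<^sub>i - 1 - s\<^sub>i\<close> steps down; \<open>height j s\<close> is the level of its
  \<open>j\<close>-th peak.\<close>

definition height :: "nat \<Rightarrow> mon \<Rightarrow> int" where
  "height j s = 2 * (\<Sum>i=1..<j. int (lookup s i)) + int (lookup s j) - int k - (\<Sum>i=1..<j. int (m i) - 1)"

text \<open>These turn out to be the monomials outside the initial ideal.\<close>

definition standard :: "mon \<Rightarrow> bool" where
  "standard s \<longleftrightarrow> s \<in> monomials n \<and> m_free n m s \<and> (\<forall>j\<in>{1..n}. height j s < 0)"

lemma height_add:
  "height j (s + u) = height j s + 2 * (\<Sum>i=1..<j. int (lookup u i)) + int (lookup u j)"
  by (simp add: height_def lookup_add sum.distrib algebra_simps)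

lemma height_mono: "mdvd s t \<Longrightarrow> height j s \<le> height j t"
  by (auto simp: mdvd_def height_add sum_nonneg)

lemma height_1: "height (Suc 0) s = int (lookup s 1) - int k"
  by (simp add: height_def)

lemma height_Suc:
  "j \<ge> 1 \<Longrightarrow> height (Suc j) s = height j s + int (lookup s j) - (int (m j) - 1) + int (lookup s (Suc j))"
  by (simp add: height_def algebra_simps)

lemma height_cong:
  "(\<And>i. i \<in> {1..j} \<Longrightarrow> lookup s i = lookup t i) \<Longrightarrow> j \<ge> 1 \<Longrightarrow> height j s = height j t"
  by (simp add: height_def)

lemma crit_bar_iff:
  assumes "j \<ge> 1"
  shows "s \<in> crit_bar n m k j \<longleftrightarrow>
    s \<in> monomials n \<and> m_free n m s \<and> lookup s j \<ge> 1 \<and> height j s = 0"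
proof -
  have "mdvd (single j 1) s \<longleftrightarrow> lookup s j \<ge> 1"
    by (auto simp: mdvd_iff lookup_single when_def)
  moreover have "int (mdeg (trunc j s)) = (\<Sum>i=1..<j. int (lookup s i)) + int (lookup s j)"
    using assms by (simp add: mdeg_trunc flip: atLeastLessThanSuc_atLeastAtMost)
  moreover have "(\<Sum>i=1..<j. int (m i) - 1) = (\<Sum>i=1..<j. int (m i)) - (int j - 1)"
    using assms by (simp add: sum_subtractf of_nat_diff)
  ultimately show ?thesis
    by (auto simp: crit_bar_def height_def)
qed

text \<open>The divisor drops all variables after \<open>x_j\<close> and lowers the exponent of
  \<open>x_j\<close> until the peak sits exactly at level 0.\<close>

lemma first_peak_divisor:
  assumes s: "s \<in> monomials n" "m_free n m s"
    and j: "j \<in> {1..n}" "height j s \<ge> 0" "\<And>l. l \<in> {1..<j} \<Longrightarrow> height l s < 0"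
  obtains t where "mdvd t s" "t \<in> crit_bar n m k j" "t \<in> monomials j"
proof -
  \<comment> \<open>This is the level of the valley before the \<open>j\<close>-th peak: the start
    level \<open>- k\<close>, or the previous, negative peak followed by steps down. It ensures that
    the lowered exponent stays positive.\<close>
  have neg: "height j s - int (lookup s j) < 0"
  proof (cases "j = 1")
    case True
    then show ?thesis
      using k_pos by (simp add: height_1)
  next
    case False
    then obtain l where l: "j = Suc l" "l \<ge> 1"
      using j(1) by (cases j) auto
    moreover have "lookup s l < m l"
      using s(2) j(1) l by (auto simp: m_free_def)
    ultimately show ?thesis
      using j(3)[of l] by (simp add: height_Suc)
  qed
  define a where "a = nat (int (lookup s j) - height j s)"
  have a: "int a = int (lookup s j) - height j s" "a \<ge> 1" "a \<le> lookup s j"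
    using neg j(2) by (auto simp: a_def)
  define t where "t = trunc (j - 1) s + single j a"
  have t_lookup: "lookup t i = (if 1 \<le> i \<and> i < j then lookup s i else if i = j then a else 0)" for i
    using j(1) by (auto simp: t_def lookup_add lookup_trunc lookup_single when_def)
  have dvd: "mdvd t s"
    using a by (simp add: mdvd_iff t_lookup)
  have "height j t = height j s - int (lookup s j) + int a"
    using j(1) by (simp add: height_def t_lookup)
  then have "height j t = 0"
    using a by simp
  moreover have "lookup t j \<ge> 1"
    using a by (simp add: t_lookup)
  moreover have "t \<in> monomials n" "m_free n m t"
    using dvd s mdvd_monomials m_free_mdvd by auto
  ultimately have "t \<in> crit_bar n m k j"
    using j(1) by (subst crit_bar_iff) auto
  moreover have "t \<in> monomials j"
    using a(2) j(1) by (intro monomialsI) (auto simp: t_lookup)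
  ultimately show thesis
    using that dvd by blast
qed

lemma ex_first_peak:
  assumes "j \<in> {1..n}" "height j s \<ge> 0"
  obtains l where "l \<in> {1..j}" "height l s \<ge> 0" "\<And>i. i \<in> {1..<l} \<Longrightarrow> height i s < 0"
proof -
  define l where "l = (LEAST l. l \<ge> 1 \<and> height l s \<ge> 0)"
  have "l \<ge> 1 \<and> height l s \<ge> 0"
    unfolding l_def by (rule LeastI[of _ j]) (use assms in auto)
  moreover have "l \<le> j"
    unfolding l_def by (rule Least_le) (use assms in auto)
  moreover have "height i s < 0" if "i \<in> {1..<l}" for i
  proof -
    have "\<not> (i \<ge> 1 \<and> height i s \<ge> 0)"
      using that unfolding l_def by (intro not_less_Least) simp
    with that show ?thesis
      by simp
  qed
  ultimately show thesis
    using that by auto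
qed

text \<open>Having a divisor in an earlier \<open>crit_bar\<close> amounts to having an earlier peak
  of nonnegative height: the first such peak yields a divisor by \<open>first_peak_divisor\<close>,
  and heights are monotone under divisibility.\<close>

lemma crit_iff:
  assumes j: "j \<in> {1..n}"
  shows "s \<in> crit n m k j \<longleftrightarrow> s \<in> monomials j \<and> m_free n m s \<and> lookup s j \<ge> 1 \<and> height j s = 0 \<and>
    (\<forall>l\<in>{1..<j}. height l s < 0)"
proof -
  have mon: "s \<in> monomials n" if "s \<in> monomials j"
    using that monomials_mono[of j n] j by auto
  have "(\<exists>l\<in>{1..<j}. \<exists>t\<in>crit_bar n m k l. mdvd t s) \<longleftrightarrow> (\<exists>l\<in>{1..<j}. height l s \<ge> 0)"
    if s: "s \<in> monomials j" "m_free n m s"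
  proof
    assume "\<exists>l\<in>{1..<j}. height l s \<ge> 0"
    then obtain l where "l \<in> {1..<j}" "height l s \<ge> 0"
      by blast
    moreover have "l \<in> {1..n}"
      using j \<open>l \<in> {1..<j}\<close> by auto
    ultimately obtain i where i: "i \<in> {1..l}" "height i s \<ge> 0" "\<And>l. l \<in> {1..<i} \<Longrightarrow> height l s < 0"
      using ex_first_peak[of l s] by blast
    have "i \<in> {1..n}" "i \<in> {1..<j}"
      using i(1) \<open>l \<in> {1..<j}\<close> j by auto
    then obtain t where "mdvd t s" "t \<in> crit_bar n m k i"
      using first_peak_divisor[OF mon[OF s(1)] s(2) _ i(2,3)] by blast
    then show "\<exists>l\<in>{1..<j}. \<exists>t\<in>crit_bar n m k l. mdvd t s"
      using \<open>i \<in> {1..<j}\<close> by blast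
  next
    assume "\<exists>l\<in>{1..<j}. \<exists>t\<in>crit_bar n m k l. mdvd t s"
    then obtain l t where lt: "l \<in> {1..<j}" "t \<in> crit_bar n m k l" "mdvd t s"
      by blast
    then have "height l t = 0"
      using crit_bar_iff[of l t] by auto
    then have "height l s \<ge> 0"
      using height_mono[OF lt(3), of l] by simp
    with lt(1) show "\<exists>l\<in>{1..<j}. height l s \<ge> 0"
      by blast
  qed
  moreover have "s \<in> crit_bar n m k j \<longleftrightarrow>
      s \<in> monomials n \<and> m_free n m s \<and> lookup s j \<ge> 1 \<and> height j s = 0"
    using j by (intro crit_bar_iff) simp
  ultimately show ?thesis
    using mon by (auto simp: crit_def not_le[symmetric] simp del: not_le)
qed

text \<open>The first peak of nonnegative height supplies the divisor. Once the \<open>g_s\<close>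
  are known to have initial monomials \<open>s\<close>, this makes every \<open>m\<close>-free
  nonstandard monomial an initial monomial of the ideal.\<close>

lemma nonstandard_crit_divisor:
  assumes "s \<in> monomials n" "m_free n m s" "\<not> standard s"
  obtains j t where "j \<in> {1..n}" "t \<in> crit n m k j" "mdvd t s"
proof -
  obtain j where "j \<in> {1..n}" "height j s \<ge> 0"
    using assms by (auto simp: standard_def not_less)
  with ex_first_peak obtain l where l: "l \<in> {1..j}" "height l s \<ge> 0"
    "\<And>i. i \<in> {1..<l} \<Longrightarrow> height i s < 0"
    by blast
  with \<open>j \<in> {1..n}\<close> have ln: "l \<in> {1..n}"
    by auto
  obtain t where t: "mdvd t s" "t \<in> crit_bar n m k l" "t \<in> monomials l"
    using first_peak_divisor[OF assms(1,2) ln l(2,3)] by blast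
  have "\<forall>i\<in>{1..<l}. height i t < 0"
    using l(3) height_mono[OF t(1)] le_less_trans by blast
  then have "t \<in> crit n m k l"
    using t ln crit_bar_iff[of l t] by (subst crit_iff) auto
  with that ln t show thesis
    by blast
qed

lemma crit_not_mdvd_standard:
  assumes "j \<in> {1..n}" "t \<in> crit n m k j" "standard s"
  shows "\<not> mdvd t s"
proof
  assume "mdvd t s"
  then have "height j t \<le> height j s"
    by (rule height_mono)
  moreover have "height j t = 0"
    using assms(2) unfolding crit_iff[OF assms(1)] by blast
  moreover have "height j s < 0"
    using assms by (simp add: standard_def)
  ultimately show False
    by simp
qed

text \<open>Critical monomials form an antichain. Since \<open>x_i\<close> divides \<open>t\<close>,
  \<open>i <= j\<close>; and \<open>i < j\<close> would give \<open>t\<close> an early peak of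
  nonnegative height. For \<open>i = j\<close> both heights are 0, while every variable up to
  \<open>x_j\<close> in the quotient would raise the height.\<close>

lemma crit_mdvd_crit:
  assumes "i \<in> {1..n}" "j \<in> {1..n}" "s \<in> crit n m k i" "t \<in> crit n m k j" "mdvd s t"
  shows "i = j" "s = t"
proof -
  have s: "s \<in> monomials i" "lookup s i \<ge> 1" "height i s = 0"
    using assms(3) unfolding crit_iff[OF assms(1)] by auto
  have t: "t \<in> monomials j" "height j t = 0" "\<forall>l\<in>{1..<j}. height l t < 0"
    using assms(4) unfolding crit_iff[OF assms(2)] by auto
  have "lookup t i \<ge> 1"
    using assms(5) s(2) order_trans unfolding mdvd_iff by blast
  then have "i \<le> j"
    using lookup_monomials_eq_0[OF t(1), of i] by fastforce
  moreover have "\<not> i < j"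
  proof
    assume "i < j"
    with assms(1) t(3) have "height i t < 0"
      by simp
    with height_mono[OF assms(5), of i] s(3) show False
      by simp
  qed
  ultimately show ij: "i = j"
    by simp
  obtain u where u: "t = s + u"
    using assms(5) mdvd_def by auto
  have "2 * (\<Sum>i=1..<j. int (lookup u i)) + int (lookup u j) = 0"
    using s(3) t(2) ij by (simp add: u height_add)
  then have z: "(\<Sum>i=1..<j. int (lookup u i)) = 0" "lookup u j = 0"
    using sum_nonneg[of "{1..<j}" "\<lambda>i. int (lookup u i)"] by linarith+
  then have "lookup u l = 0" if "l \<in> {1..<j}" for l
    using that by (simp add: sum_nonneg_eq_0_iff)
  moreover have "lookup u l = 0" if "l \<notin> {1..j}" for l
    using lookup_monomials_eq_0[OF t(1) that] by (simp add: u lookup_add)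
  ultimately have "lookup u l = 0" for l
    using z(2) by (cases "l = j"; cases "l \<in> {1..j}") auto
  then have "u = 0"
    by (intro poly_mapping_eqI) simp
  with u show "s = t"
    by simp
qed

text \<open>The left-hand side is the final level of the path, which is reached by going down from
  the last peak, or is \<open>- k\<close> if there is no block.\<close>

lemma standard_end_level:
  assumes "standard s"
  shows "2 * int (mdeg s) - int k - (\<Sum>i=1..n. int (m i) - 1) < 0"
proof (cases "n = 0")
  case True
  moreover have "s \<in> monomials n"
    using assms by (simp add: standard_def)
  ultimately show ?thesis
    using k_pos mdeg_eq_sum[of s n] by simp
next
  case False
  then have "{1..n} = {1..<Suc n}" "n \<ge> 1"
    by auto
  moreover from this have "height n s < 0" "lookup s n < m n"
    using assms by (auto simp: standard_def m_free_def)
  moreover have "mdeg s = (\<Sum>i=1..n. lookup s i)"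
    using assms mdeg_eq_sum by (simp add: standard_def)
  ultimately show ?thesis
    by (simp add: height_def)
qed

text \<open>Reflection principle. Read \<open>u\<close> as a path from level \<open>k\<close> that
  in block \<open>i\<close> first takes \<open>m i - 1 - lookup u i\<close> steps down and then
  \<open>lookup u i\<close> steps up. By \<open>neg\<close> it ends below 0, so it meets level 0;
  let \<open>j\<close> be the first block where it does. Reflecting everything before the meeting
  point gives a path from \<open>- k\<close>, and moving all up steps of block \<open>j\<close> to
  its front gives the path of \<open>s\<close>. Its \<open>j\<close>-th peak has height
  \<open>lookup u j\<close>, so \<open>u\<close> can be recovered.\<close>

lemma reflection:
  assumes u: "u \<in> monomials n" "m_free n m u"
    and neg: "2 * int (mdeg u) + int k - (\<Sum>i=1..n. int (m i) - 1) < 0"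
  obtains j s where "j \<in> {1..n}" "s \<in> m_free_mons n m (mdeg u + k)"
    "height j s = int (lookup u j)" "\<And>i. i \<in> {1..<j} \<Longrightarrow> height i s < 0"
    "\<And>i. i \<in> {1..<j} \<Longrightarrow> lookup u i = m i - 1 - lookup s i" "\<And>i. i > j \<Longrightarrow> lookup u i = lookup s i"
proof -
  \<comment> \<open>\<open>v l\<close> is the level of the path of \<open>u\<close> before block
    \<open>l\<close>.\<close>
  define v where "v l = int k + 2 * (\<Sum>i=1..<l. int (lookup u i)) - (\<Sum>i=1..<l. int (m i) - 1)" for l
  have v_Suc: "v (Suc l) = v l + 2 * int (lookup u l) - (int (m l) - 1)" if "l \<ge> 1" for l
    using that by (simp add: v_def)
  have u_lt: "lookup u i < m i" if "i \<in> {1..n}" for i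
    using u(2) that by (simp add: m_free_def)
  \<comment> \<open>For \<open>v l > 0\<close> this says that the descent in block \<open>l\<close>
    reaches level 0.\<close>
  define P where "P l \<longleftrightarrow> l \<ge> 1 \<and> v l + int (lookup u l) \<le> int (m l) - 1" for l
  have pos: "v l > 0" if "\<And>i. i \<in> {1..<l} \<Longrightarrow> \<not> P i" "l \<ge> 1" for l
    using that(2,1)
  proof (induction l rule: dec_induct)
    case base
    then show ?case
      using k_pos by (simp add: v_def)
  next
    case (step l)
    then have "\<not> P l"
      by simp
    then show ?case
      using step.hyps by (simp add: v_Suc P_def)
  qed
  \<comment> \<open>Otherwise all block ends would stay positive, including the final level, against
    \<open>neg\<close>.\<close>
  have "\<exists>j\<in>{1..n}. P j"
  proof (rule ccontr)
    assume "\<not> ?thesis"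
    then have "v (Suc n) > 0"
      by (intro pos) auto
    moreover have "mdeg u = (\<Sum>i=1..<Suc n. lookup u i)"
      using mdeg_eq_sum[OF u(1)] by (simp add: atLeastLessThanSuc_atLeastAtMost)
    ultimately show False
      using neg by (simp add: v_def atLeastLessThanSuc_atLeastAtMost)
  qed
  then obtain j0 where j0: "j0 \<in> {1..n}" "P j0"
    by blast
  define j where "j = (LEAST j. P j)"
  have Pj: "P j"
    unfolding j_def using j0 by (rule_tac LeastI)
  have "j \<le> j0"
    unfolding j_def using j0 by (rule_tac Least_le)
  with Pj j0 have j: "j \<in> {1..n}"
    by (auto simp: P_def)
  have nP: "\<not> P i" if "i < j" for i
    using not_less_Least[of i P] that by (simp add: j_def)
  have v_pos: "v j > 0"
    using nP j by (intro pos) auto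
  \<comment> \<open>Before block \<open>j\<close> up and down steps are exchanged; in block
    \<open>j\<close> the \<open>v j\<close> steps down to level 0 become steps up; later blocks are
    kept.\<close>
  define s where "s = (\<Sum>i=1..n. single i
    (if i < j then m i - 1 - lookup u i else if i = j then lookup u j + nat (v j) else lookup u i))"
  have s_lookup: "lookup s i = (if i \<in> {1..n} then if i < j then m i - 1 - lookup u i
      else if i = j then lookup u j + nat (v j) else lookup u i else 0)" for i
    by (simp add: s_def lookup_sum lookup_single when_def)
  have s_lt: "int (lookup s i) = int (m i) - 1 - int (lookup u i)" if "i \<in> {1..<j}" for i
    using that j u_lt[of i] by (simp add: s_lookup)
  have s_j: "int (lookup s j) = int (lookup u j) + v j"
    using j v_pos by (simp add: s_lookup)
  have s_mon: "s \<in> monomials n"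
    by (rule monomialsI) (simp add: s_lookup del: atLeastAtMost_iff)
  have s_free: "m_free n m s"
    unfolding m_free_def
  proof
    fix i assume i: "i \<in> {1..n}"
    consider "i < j" | "i = j" | "i > j"
      by linarith
    then show "lookup s i < m i"
    proof cases
      case 1
      then show ?thesis
        using s_lt[of i] i by simp
    next
      case 2
      then show ?thesis
        using s_j Pj by (simp add: P_def)
    next
      case 3
      then show ?thesis
        using u_lt[OF i] i by (simp add: s_lookup)
    qed
  qed
  have height: "height i s = - v i + int (lookup s i)" if "i \<in> {1..j}" for i
  proof -
    have "(\<Sum>l=1..<i. int (lookup s l)) = (\<Sum>l=1..<i. int (m l) - 1 - int (lookup u l))"
      using that by (intro sum.cong refl s_lt) auto
    then show ?thesis
      by (simp add: height_def v_def sum_subtractf)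
  qed
  have split: "(\<Sum>i=1..n. int (f i)) = (\<Sum>i=1..<j. int (f i)) + int (f j) + (\<Sum>i=Suc j..n. int (f i))"
    for f :: "nat \<Rightarrow> nat"
  proof -
    have "{1..n} = {1..<j} \<union> {j..n}" "{j..n} = insert j {Suc j..n}"
      using j by auto
    moreover have "(\<Sum>i\<in>{1..<j} \<union> {j..n}. int (f i)) = (\<Sum>i=1..<j. int (f i)) + (\<Sum>i=j..n. int (f i))"
      by (intro sum.union_disjoint) auto
    ultimately show ?thesis
      by simp
  qed
  have tail: "(\<Sum>i=Suc j..n. int (lookup s i)) = (\<Sum>i=Suc j..n. int (lookup u i))"
    using j by (intro sum.cong) (auto simp: s_lookup)
  have head: "(\<Sum>i=1..<j. int (lookup s i)) = (\<Sum>i=1..<j. int (m i) - 1 - int (lookup u i))"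
    by (intro sum.cong refl s_lt)
  have "int (mdeg s) = int (mdeg u + k)"
    using split[of "lookup s"] split[of "lookup u"] head tail s_j
    by (simp add: mdeg_eq_sum[OF s_mon] mdeg_eq_sum[OF u(1)] v_def sum_subtractf)
  then have "s \<in> m_free_mons n m (mdeg u + k)"
    using s_mon s_free by (simp add: m_free_mons_def)
  moreover have "height j s = int (lookup u j)"
    using height[of j] s_j j by simp
  moreover have "height i s < 0" if "i \<in> {1..<j}" for i
    using height[of i] s_lt[of i] nP[of i] that by (simp add: P_def)
  moreover have "lookup u i = m i - 1 - lookup s i" if "i \<in> {1..<j}" for i
    using s_lt[OF that] by linarith
  moreover have "lookup u i = lookup s i" if "i > j" for i
    using that lookup_monomials_eq_0[OF u(1), of i] by (auto simp: s_lookup)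
  ultimately show thesis
    using that[OF j] by blast
qed

text \<open>The hypothesis says that a path of degree \<open>d\<close> from \<open>- k\<close> ends
  below 0. The reflected monomials are nonstandard, having a nonnegative peak, and
  \<open>reflection\<close> provides the data for injectivity.\<close>

lemma card_nonstandard_ge:
  assumes "2 * int d - int k - (\<Sum>i=1..n. int (m i) - 1) < 0"
  shows "card {u \<in> monomials n. m_free n m u \<and> mdeg u + k = d}
    \<le> card {s \<in> m_free_mons n m d. \<not> standard s}" (is "card ?U \<le> card ?S")
proof -
  define R where "R u j s \<longleftrightarrow> j \<in> {1..n} \<and> s \<in> m_free_mons n m d \<and>
    height j s = int (lookup u j) \<and> (\<forall>i\<in>{1..<j}. height i s < 0) \<and>
    (\<forall>i\<in>{1..<j}. lookup u i = m i - 1 - lookup s i) \<and> (\<forall>i>j. lookup u i = lookup s i)" for u j s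
  have "\<exists>js. R u (fst js) (snd js)" if "u \<in> ?U" for u
  proof -
    have "2 * int (mdeg u) + int k - (\<Sum>i=1..n. int (m i) - 1) < 0"
      using that assms by auto
    moreover have "u \<in> monomials n" "m_free n m u" "d = mdeg u + k"
      using that by auto
    ultimately show ?thesis
    proof (elim reflection[rotated 2])
      fix j s
      assume "j \<in> {1..n}" "s \<in> m_free_mons n m (mdeg u + k)"
        "height j s = int (lookup u j)" "\<And>i. i \<in> {1..<j} \<Longrightarrow> height i s < 0"
        "\<And>i. i \<in> {1..<j} \<Longrightarrow> lookup u i = m i - 1 - lookup s i"
        "\<And>i. i > j \<Longrightarrow> lookup u i = lookup s i"
      with \<open>d = mdeg u + k\<close> show ?thesis
        by (intro exI[of _ "(j, s)"]) (simp add: R_def)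
    qed
  qed
  then have "\<exists>f. \<forall>u\<in>?U. R u (fst (f u)) (snd (f u))"
    by (intro bchoice ballI)
  then obtain f where f: "\<And>u. u \<in> ?U \<Longrightarrow> R u (fst (f u)) (snd (f u))"
    by blast
  show ?thesis
  proof (rule card_inj_on_le)
    show "inj_on (\<lambda>u. snd (f u)) ?U"
    proof (rule inj_onI)
      fix u u' assume u: "u \<in> ?U" "u' \<in> ?U" and eq: "snd (f u) = snd (f u')"
      obtain j j' s where fu: "f u = (j, s)" "f u' = (j', s)"
        using eq by (metis prod.collapse)
      have R: "R u j s" "R u' j' s"
        using f[OF u(1)] f[OF u(2)] by (simp_all add: fu)
      then have "height j s \<ge> 0" "height j' s \<ge> 0" "j \<ge> 1" "j' \<ge> 1"
        "\<forall>i\<in>{1..<j}. height i s < 0" "\<forall>i\<in>{1..<j'}. height i s < 0"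
        by (simp_all add: R_def)
      \<comment> \<open>The block is determined by \<open>s\<close> as that of its first nonnegative
        peak; the exponents of \<open>u\<close> before, at and after it can then be read
        off.\<close>
      then have "\<not> j < j'" "\<not> j' < j"
        by (simp_all add: Ball_def flip: not_le) (metis less_le_not_le not_le)+
      then have "j = j'"
        by simp
      show "u = u'"
      proof (rule poly_mapping_eqI)
        fix i
        consider "i < 1" | "i \<in> {1..<j}" | "i = j" | "i > j"
          by fastforce
        then show "lookup u i = lookup u' i"
        proof cases
          case 1
          then show ?thesis
            using u lookup_monomials_eq_0[of u n i] lookup_monomials_eq_0[of u' n i] by simp
        qed (use R \<open>j = j'\<close> in \<open>auto simp: R_def\<close>)
      qed
    qed
    have "snd (f u) \<in> ?S" if "u \<in> ?U" for u
    proof -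
      have "fst (f u) \<in> {1..n}" "height (fst (f u)) (snd (f u)) \<ge> 0" "snd (f u) \<in> m_free_mons n m d"
        using f[OF that] by (simp_all add: R_def)
      then show ?thesis
        by (auto simp: standard_def not_less)
    qed
    then show "(\<lambda>u. snd (f u)) ` ?U \<subseteq> ?S"
      by blast
    show "finite ?S"
      using finite_m_free_mons by simp
  qed
qed

end

subsection \<open>The polynomials \<open>g\<^sub>s\<close> lie in the ideal\<close>

lemma finite_difference_sum:
  fixes g :: "nat \<Rightarrow> 'a::comm_ring_1"
  shows "(\<Sum>b\<le>Suc c. (- 1) ^ b * of_nat (Suc c choose b) * g b)
    = (\<Sum>b\<le>c. (- 1) ^ b * of_nat (c choose b) * (g b - g (Suc b)))"
proof -
  \<comment> \<open>The added summand \<open>b = Suc c\<close> is 0, which makes the ranges match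
    before Pascal's rule is applied.\<close>
  have "(\<Sum>b\<le>c. (- 1) ^ b * of_nat (c choose b) * g b) = (\<Sum>b\<le>Suc c. (- 1) ^ b * of_nat (c choose b) * g b)"
    by (simp add: binomial_eq_0)
  also have "\<dots> = g 0 - (\<Sum>b\<le>c. (- 1) ^ b * of_nat (c choose Suc b) * g (Suc b))"
    by (subst sum.atMost_Suc_shift) (simp add: sum_negf)
  finally show ?thesis
    by (subst sum.atMost_Suc_shift) (simp add: sum_negf sum_subtractf sum.distrib algebra_simps)
qed

text \<open>By inclusion-exclusion both sides count the \<open>a\<close>-subsets of an
  \<open>N\<close>-set that avoid \<open>c\<close> given points. In the induction, Pascal's rule
  turns one finite difference into the replacement of \<open>N\<close> by
  \<open>N - 1\<close>.\<close>

lemma alternating_binomial_sum: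
  "c \<le> N \<Longrightarrow> (\<Sum>b\<le>c. (- 1) ^ b * of_nat (c choose b) * (if b \<le> a then of_nat ((N - b) choose (a - b)) else 0))
    = (of_nat ((N - c) choose a) :: 'a::comm_ring_1)"
proof (induction c arbitrary: N)
  case (Suc c)
  have "(if b \<le> a then of_nat ((N - b) choose (a - b)) else 0) -
      (if Suc b \<le> a then of_nat ((N - Suc b) choose (a - Suc b)) else 0)
    = (if b \<le> a then of_nat ((N - 1 - b) choose (a - b)) else 0 :: 'a)" if b: "b \<le> c" for b
  proof (cases "b < a")
    case True
    then obtain e f where "a - b = Suc e" "N - b = Suc f"
      using Suc.prems b by (metis Suc_diff_Suc le_less_trans less_eq_Suc_le)
    moreover from this have "a - Suc b = e" "N - Suc b = f" "N - 1 - b = f"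
      by auto
    ultimately show ?thesis
      using True by simp
  qed (auto simp: not_less_iff_gr_or_eq)
  then have "(\<Sum>b\<le>Suc c. (- 1) ^ b * of_nat (Suc c choose b) * (if b \<le> a then of_nat ((N - b) choose (a - b)) else 0))
     = (\<Sum>b\<le>c. (- 1) ^ b * of_nat (c choose b) * (if b \<le> a then of_nat ((N - 1 - b) choose (a - b)) else 0 :: 'a))"
    unfolding finite_difference_sum by (intro sum.cong refl) simp
  also have "\<dots> = of_nat ((N - 1 - c) choose a)"
    using Suc.prems by (intro Suc.IH) simp
  finally show ?case
    by simp
qed simp

section \<open>Exponential series with polynomial coefficients\<close>

lemma single_single_power:
  "single (single i 1) c ^ e = (single (single i e) (c ^ e) :: ('a::comm_ring_1) mpol)"
  by (induction e) (simp_all add: mult_single mult.commute flip: single_add)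

lemma prod_single:
  "(\<Prod>i\<in>A. single (u i) (c i)) = (single (\<Sum>i\<in>A. u i) (\<Prod>i\<in>A. c i) :: ('a::comm_ring_1) mpol)"
  by (induction A rule: infinite_finite_induct) (simp_all add: mult_single)

definition mexp :: "('a::field_char_0) mpol \<Rightarrow> 'a mpol fps" where
  "mexp p = Abs_fps (\<lambda>N. single 0 (1 / fact N) * p ^ N)"

lemma mexp_nth: "fps_nth (mexp p) N = single 0 (1 / fact N) * p ^ N"
  by (simp add: mexp_def)

text \<open>The Cauchy product becomes the binomial expansion because
  \<open>1 / (i! (N - i)!)\<close> equals \<open>(N choose i) / N!\<close>.\<close>

lemma mexp_add: "mexp (p + q) = mexp p * mexp q"
proof (rule fps_ext)
  fix N
  have "fps_nth (mexp p * mexp q) N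
      = (\<Sum>i=0..N. single 0 (1 / fact i) * p ^ i * (single 0 (1 / fact (N - i)) * q ^ (N - i)))"
    by (simp add: fps_mult_nth mexp_nth)
  also have "\<dots> = (\<Sum>i=0..N. single 0 (1 / fact N) * (of_nat (N choose i) * p ^ i * q ^ (N - i)))"
  proof (rule sum.cong)
    fix i assume "i \<in> {0..N}"
    then have "single 0 (1 / fact i) * single 0 (1 / fact (N - i))
        = (single 0 (1 / fact N) * of_nat (N choose i) :: 'a mpol)"
      by (simp add: mult_single binomial_fact flip: single_of_nat)
    moreover have "a * x * (b * y) = c * (d * x * y)" if "a * b = c * d" for a b c d x y :: "'a mpol"
    proof -
      have "a * x * (b * y) = (a * b) * (x * y)"
        by (simp only: mult_ac)
      then show ?thesis
        unfolding that by (simp only: mult_ac)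
    qed
    ultimately show "single 0 (1 / fact i) * p ^ i * (single 0 (1 / fact (N - i)) * q ^ (N - i))
        = single 0 (1 / fact N) * (of_nat (N choose i) * p ^ i * q ^ (N - i))"
      by blast
  qed simp
  also have "\<dots> = single 0 (1 / fact N) * (p + q) ^ N"
    by (simp add: binomial_ring sum_distrib_left atLeast0AtMost)
  finally show "fps_nth (mexp (p + q)) N = fps_nth (mexp p * mexp q) N"
    by (simp add: mexp_nth)
qed

lemma mexp_0: "mexp 0 = 1"
  by (rule fps_ext) (simp add: mexp_nth power_0_left)

lemma mexp_sum: "mexp (\<Sum>i\<in>A. f i) = (\<Prod>i\<in>A. mexp (f i))"
  by (induction A rule: infinite_finite_induct) (simp_all add: mexp_0 mexp_add)

text \<open>In the notation of the header, \<open>gfactor m s i\<close> is \<open>P\<^sub>i(x\<^sub>i z)\<close> and \<open>mexp p\<close> is \<open>exp (p z)\<close>.\<close>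

definition gcoeff :: "(nat \<Rightarrow> nat) \<Rightarrow> mon \<Rightarrow> nat \<Rightarrow> nat \<Rightarrow> 'a::field_char_0" where
  "gcoeff m s i b = fact (lookup s i) / fact b * of_nat ((m i - b - 1) choose (lookup s i - b))"

definition gfactor :: "(nat \<Rightarrow> nat) \<Rightarrow> mon \<Rightarrow> nat \<Rightarrow> ('a::field_char_0) mpol fps" where
  "gfactor m s i = (\<Sum>b\<le>lookup s i. fps_const (single (single i b) (gcoeff m s i b)) * fps_X ^ b)"

lemma gfactor_nth:
  "fps_nth (gfactor m s i) c = (if c \<le> lookup s i then single (single i c) (gcoeff m s i c) else 0)"
  by (simp add: gfactor_def fps_sum_nth if_distrib sum.delta cong: if_cong)

text \<open>Up to a scalar the coefficient is the alternating sum with value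
  \<open>(m i - 1 - c) choose (lookup s i)\<close>, which vanishes because the upper entry is
  smaller than the lower one.\<close>

lemma gfactor_mexp_nth:
  assumes "lookup s i < m i" "c < m i" "m i - lookup s i \<le> c"
  shows "fps_nth (gfactor m s i * mexp (- X i)) c = (0 :: ('a::field_char_0) mpol)"
proof -
  let ?a = "lookup s i"
  have X: "- X i = (single (single i 1) (- 1) :: 'a mpol)"
    by (simp add: X_def mon_poly_def single_uminus)
  have "fps_nth (gfactor m s i * mexp (- X i)) c = (\<Sum>b=0..c. if b \<le> ?a then
      single (single i b) (gcoeff m s i b) * (single 0 (1 / fact (c - b)) * (- X i) ^ (c - b)) else (0 :: 'a mpol))"
    unfolding fps_mult_nth gfactor_nth mexp_nth by (rule sum.cong[OF refl]) (simp only: mult_zero_left split: if_split, simp)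
  also have "\<dots> = (\<Sum>b=0..c. single (single i c) (fact ?a / fact c * (- 1) ^ c *
      ((- 1) ^ b * of_nat (c choose b) * (if b \<le> ?a then of_nat ((m i - 1 - b) choose (?a - b)) else 0))))"
  proof (rule sum.cong)
    fix b assume b: "b \<in> {0..c}"
    \<comment> \<open>Splitting the sign lets the factor depending only on \<open>c\<close> be
      pulled out of the sum over \<open>b\<close>.\<close>
    have s: "(- 1) ^ (c - b) = ((- 1) ^ c * (- 1) ^ b :: 'a)"
      using b by (simp add: minus_one_power_iff)
    have *: "gcoeff m s i b * ((- 1) ^ (c - b) / fact (c - b)) = fact ?a / fact c * (- 1) ^ c *
      ((- 1) ^ b * of_nat (c choose b) * of_nat ((m i - 1 - b) choose (?a - b)) :: 'a)"
      using b unfolding s by (simp add: gcoeff_def binomial_fact diff_commute)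
    have "single (single i b) (gcoeff m s i b) * (single 0 (1 / fact (c - b)) * (- X i) ^ (c - b))
      = single (single i c) (gcoeff m s i b * ((- 1) ^ (c - b) / fact (c - b)) :: 'a)"
      using b unfolding X single_single_power by (simp add: mult_single flip: single_add)
    then show "(if b \<le> ?a then single (single i b) (gcoeff m s i b) *
        (single 0 (1 / fact (c - b)) * (- X i) ^ (c - b)) else 0) = single (single i c) (fact ?a / fact c * (- 1) ^ c *
      ((- 1) ^ b * of_nat (c choose b) * (if b \<le> ?a then of_nat ((m i - 1 - b) choose (?a - b)) else 0)) :: 'a)"
      unfolding * by simp
  qed simp
  also have "\<dots> = single (single i c) (fact ?a / fact c * (- 1) ^ c *
      (\<Sum>b\<le>c. (- 1) ^ b * of_nat (c choose b) * (if b \<le> ?a then of_nat ((m i - 1 - b) choose (?a - b)) else 0)))"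
    by (rule poly_mapping_eqI)
      (simp add: lookup_sum lookup_single when_def sum_distrib_left atLeast0AtMost)
  also have "\<dots> = 0"
  proof -
    have "m i - 1 - c < ?a"
      using assms by linarith
    then show ?thesis
      using assms by (subst alternating_binomial_sum) (auto simp: binomial_eq_0)
  qed
  finally show ?thesis .
qed

lemma fps_const_prod: "(\<Prod>i\<in>A. fps_const (c i :: 'a::comm_ring_1)) = fps_const (\<Prod>i\<in>A. c i)"
  by (induction A rule: infinite_finite_induct) simp_all

text \<open>Choosing one term from each factor is the same as choosing a divisor \<open>t\<close> of
  \<open>trunc (j - 1) s\<close>. This matches the product with the sum that defines
  \<open>g_s\<close>.\<close>

lemma prod_gfactor:
  assumes "j \<ge> 1"
  shows "(\<Prod>i=1..<j. gfactor m s i) = (\<Sum>t | mdvd t (trunc (j - 1) s).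
    fps_const (single t (\<Prod>i=1..<j. gcoeff m s i (lookup t i))) * fps_X ^ mdeg t)"
proof -
  let ?A = "{1..<j}"
  have A: "?A = {1..j - 1}"
    using assms by auto
  have "(\<Prod>i=1..<j. gfactor m s i) = (\<Sum>g\<in>(\<Pi>\<^sub>E i\<in>?A. {..lookup s i}).
      \<Prod>i=1..<j. fps_const (single (single i (g i)) (gcoeff m s i (g i))) * fps_X ^ g i)"
    unfolding gfactor_def by (rule prod_sum_PiE) auto
  also have "\<dots> = (\<Sum>t | mdvd t (trunc (j - 1) s).
    fps_const (single t (\<Prod>i=1..<j. gcoeff m s i (lookup t i))) * fps_X ^ mdeg t)"
  proof (rule sum.reindex_bij_witness[of _ "\<lambda>t. restrict (lookup t) ?A" "\<lambda>g. \<Sum>i\<in>?A. single i (g i)"])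
    fix g assume g: "g \<in> (\<Pi>\<^sub>E i\<in>?A. {..lookup s i})"
    have l: "lookup (\<Sum>i\<in>?A. single i (g i)) i = (if i \<in> ?A then g i else 0)" for i
      by (simp add: lookup_sum lookup_single when_def)
    show "restrict (lookup (\<Sum>i\<in>?A. single i (g i))) ?A = g"
      unfolding restrict_def l using g by (auto simp: PiE_def extensional_def)
    show "(\<Sum>i\<in>?A. single i (g i)) \<in> {t. mdvd t (trunc (j - 1) s)}"
      using g unfolding mem_Collect_eq mdvd_iff lookup_trunc l A[symmetric] by auto
    have "(\<Sum>i\<in>?A. single i (g i)) \<in> monomials (j - 1)"
      by (rule monomialsI) (simp only: l A[symmetric] if_False)
    from mdeg_eq_sum[OF this] have "mdeg (\<Sum>i\<in>?A. single i (g i)) = (\<Sum>i\<in>?A. g i)"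
      unfolding l A[symmetric] by simp
    then show "fps_const (single (\<Sum>i\<in>?A. single i (g i)) (\<Prod>i=1..<j. gcoeff m s i (lookup (\<Sum>i\<in>?A. single i (g i)) i)))
        * fps_X ^ mdeg (\<Sum>i\<in>?A. single i (g i))
      = (\<Prod>i=1..<j. fps_const (single (single i (g i)) (gcoeff m s i (g i))) * fps_X ^ g i)"
      unfolding l by (simp add: prod.distrib prod_single power_sum fps_const_prod)
  next
    fix t assume t: "t \<in> {t. mdvd t (trunc (j - 1) s)}"
    then have "t \<in> monomials (j - 1)"
      using mdvd_monomials trunc_in_monomials by blast
    then have "lookup t i = 0" if "i \<notin> ?A" for i
      using lookup_monomials_eq_0 that unfolding A by blast
    then show "(\<Sum>i\<in>?A. single i (restrict (lookup t) ?A i)) = t"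
      by (intro poly_mapping_eqI) (auto simp: lookup_sum lookup_single when_def)
    show "restrict (lookup t) ?A \<in> (\<Pi>\<^sub>E i\<in>?A. {..lookup s i})"
      using t unfolding A by (auto simp: mdvd_iff lookup_trunc split: if_splits)
  qed
  finally show ?thesis .
qed

section \<open>Ideal membership of monomial multiples and of coefficients of power series\<close>

lemma keys_multiples_in_ideal:
  fixes J :: "('a::comm_ring_1) mpol set"
  assumes "ideal J (poly_ring n)" "\<And>i. i \<in> {1..n} \<Longrightarrow> X i ^ m i \<in> J"
    and "keys p \<subseteq> monomials n" "\<And>t. t \<in> keys p \<Longrightarrow> \<exists>i\<in>{1..n}. m i \<le> lookup t i"
  shows "p \<in> J"
proof -
  have "(\<Sum>t\<in>keys p. single t (lookup p t)) \<in> J"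
  proof (rule ideal_sum_closed[OF assms(1)])
    fix t assume t: "t \<in> keys p"
    with assms(4) obtain i where i: "i \<in> {1..n}" "m i \<le> lookup t i"
      by blast
    then have "mdvd (single i (m i)) t"
      by (simp add: mdvd_iff lookup_single when_def)
    then obtain u where u: "t = single i (m i) + u"
      by (auto simp: mdvd_def)
    then have "u \<in> monomials n"
      using t assms(3) mdvd_monomials[of u t n] mdvd_add[of u "single i (m i)"] by (auto simp: add.commute)
    then have "keys (single u (lookup p t)) \<subseteq> monomials n"
      by simp
    then have "single u (lookup p t) * X i ^ m i \<in> J"
      by (intro ideal_mult_closed[OF assms(1)] assms(2) i(1))
    moreover have "single u (lookup p t) * X i ^ m i = single t (lookup p t)"
      by (simp add: X_power mon_poly_def mult_single u add.commute)
    ultimately show "single t (lookup p t) \<in> J"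
      by simp
  qed
  then show ?thesis
    by (simp flip: poly_eq_sum)
qed

text \<open>Degrees in the series variable add up modulo \<open>J\<close>: in a Cauchy product
  beyond the total bound, one of the two factors exceeds its own bound. The claim on supports is
  carried along because \<open>J\<close> absorbs only multipliers from the carrier.\<close>

lemma fps_prod_nth_in_ideal:
  fixes J :: "('a::comm_ring_1) mpol set" and Q :: "'b \<Rightarrow> 'a mpol fps"
  assumes J: "ideal J (poly_ring n)"
    and "finite A"
    and "\<And>i c. i \<in> A \<Longrightarrow> keys (fps_nth (Q i) c) \<subseteq> monomials n"
    and "\<And>i c. i \<in> A \<Longrightarrow> c > D i \<Longrightarrow> fps_nth (Q i) c \<in> J"
  shows "keys (fps_nth (\<Prod>i\<in>A. Q i) N) \<subseteq> monomials n \<and>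
    (N > (\<Sum>i\<in>A. D i) \<longrightarrow> fps_nth (\<Prod>i\<in>A. Q i) N \<in> J)"
  using assms(2-4)
proof (induction A arbitrary: N rule: finite_induct)
  case empty
  then show ?case
    using J zero_in_monomials by (auto simp: ideal_poly_ring_iff)
next
  case (insert i A)
  let ?R = "\<Prod>i\<in>A. Q i"
  have IH: "keys (fps_nth ?R N) \<subseteq> monomials n" "N > (\<Sum>i\<in>A. D i) \<Longrightarrow> fps_nth ?R N \<in> J" for N
    using insert by auto
  have Qi: "keys (fps_nth (Q i) c) \<subseteq> monomials n" "c > D i \<Longrightarrow> fps_nth (Q i) c \<in> J" for c
    using insert by auto
  have eq: "fps_nth (\<Prod>i\<in>insert i A. Q i) N = (\<Sum>c=0..N. fps_nth (Q i) c * fps_nth ?R (N - c))"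
    using insert by (simp add: fps_mult_nth)
  have "keys (fps_nth (\<Prod>i\<in>insert i A. Q i) N) \<subseteq> monomials n"
    unfolding eq by (intro keys_sum_monomials keys_mult_monomials Qi IH)
  moreover have "fps_nth (\<Prod>i\<in>insert i A. Q i) N \<in> J" if N: "N > (\<Sum>i\<in>insert i A. D i)"
    unfolding eq
  proof (rule ideal_sum_closed[OF J])
    fix c
    show "fps_nth (Q i) c * fps_nth ?R (N - c) \<in> J"
    proof (cases "c > D i")
      case True
      then have "fps_nth ?R (N - c) * fps_nth (Q i) c \<in> J"
        by (intro ideal_mult_closed[OF J] Qi(2) IH(1))
      then show ?thesis
        by (simp add: mult.commute)
    next
      case False
      then have "N - c > (\<Sum>i\<in>A. D i)"
        using N insert.hyps by simp
      then show ?thesis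
        by (intro ideal_mult_closed[OF J] Qi(1) IH(2))
    qed
  qed
  ultimately show ?case
    by blast
qed

text \<open>Since the ideal is monomial, deletion becomes a condition on the exponents of each
  single monomial.\<close>

lemma lookup_delete_in:
  fixes p :: "('a::comm_ring_1) mpol"
  assumes "j \<ge> 1" "keys p \<subseteq> monomials n"
  shows "lookup (delete_in (Idl\<^bsub>poly_ring n\<^esub> {X i ^ m i | i. i \<in> {j..n}}) p) t
    = (if \<exists>i\<in>{j..n}. m i \<le> lookup t i then 0 else lookup p t)"
proof -
  let ?J = "Idl\<^bsub>poly_ring n\<^esub> {X i ^ m i | i. i \<in> {j..n}} :: 'a mpol set"
  let ?T = "(\<lambda>i. single i (m i)) ` {j..n}"
  have "?T \<subseteq> monomials n"
    using assms(1) by (auto intro!: single_in_monomials)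
  moreover have "{X i ^ m i | i. i \<in> {j..n}} = (mon_poly ` ?T :: 'a mpol set)"
    by (auto simp: X_power)
  ultimately have "?J = {p. keys p \<subseteq> monomials n \<and> (\<forall>t\<in>keys p. \<exists>u\<in>?T. mdvd u t)}"
    by (simp only: Idl_mon_poly)
  then have "mon_poly t \<in> ?J \<longleftrightarrow> t \<in> monomials n \<and> (\<exists>i\<in>{j..n}. mdvd (single i (m i)) t)" for t
    by simp
  moreover have "mdvd (single i (m i)) t \<longleftrightarrow> m i \<le> lookup t i" for i t
    by (auto simp: mdvd_iff lookup_single when_def)
  ultimately have J: "mon_poly t \<in> ?J \<longleftrightarrow> t \<in> monomials n \<and> (\<exists>i\<in>{j..n}. m i \<le> lookup t i)" for t
    by simp
  have "lookup (delete_in ?J p) t = (if t \<in> keys p \<and> mon_poly t \<notin> ?J then lookup p t else 0)"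
    unfolding delete_in_def by (simp add: lookup_sum lookup_single when_def)
  also have "\<dots> = (if \<exists>i\<in>{j..n}. m i \<le> lookup t i then 0 else lookup p t)"
    unfolding J using assms(2) by (auto simp: in_keys_iff)
  finally show ?thesis .
qed

lemma keys_sum_X_power:
  assumes "t \<in> keys ((\<Sum>i\<in>A. X i) ^ e :: ('a::comm_ring_1) mpol)"
  shows "mdeg t = e \<and> keys t \<subseteq> A"
  using assms
proof (induction e arbitrary: t)
  case (Suc e)
  then obtain u v where t: "t = u + v" "u \<in> keys (\<Sum>i\<in>A. X i :: 'a mpol)" "v \<in> keys ((\<Sum>i\<in>A. X i) ^ e :: 'a mpol)"
    using keys_mult[of "\<Sum>i\<in>A. X i :: 'a mpol" "(\<Sum>i\<in>A. X i) ^ e"] by auto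
  from t(2) obtain i where "i \<in> A" "u = single i 1"
    using keys_sum_subset[of "X :: nat \<Rightarrow> 'a mpol" A] by (auto simp: X_def)
  with t Suc.IH[OF t(3)] Poly_Mapping.keys_add[of u v] show ?case
    by (auto simp: mdeg_add)
qed simp

text \<open>A product of variables equals a power of \<open>x_j\<close> only if every factor is
  \<open>x_j\<close>, so in each induction step only the summand \<open>X j\<close> contributes.
  This yields the leading coefficient of \<open>g_s\<close>.\<close>

lemma lookup_sum_X_power:
  assumes "finite A" "j \<in> A"
  shows "lookup ((\<Sum>i\<in>A. X i) ^ e) (single j e) = (1 :: 'a::comm_ring_1)"
proof (induction e)
  case (Suc e)
  let ?L = "\<Sum>i\<in>A. X i :: 'a mpol"
  have "lookup (X i * ?L ^ e) (single j (Suc e)) = (if i = j then 1 else 0 :: 'a)" for i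
  proof (cases "i = j")
    case True
    have "single j (Suc e) = single j 1 + single j e"
      by (simp flip: single_add)
    then show ?thesis
      using Suc lookup_single_mult[of "single j 1" 1 "?L ^ e" "single j e"] True
      by (simp add: X_def mon_poly_def)
  next
    case False
    have "single j (Suc e) \<noteq> single i 1 + u" for u
    proof
      assume "single j (Suc e) = single i 1 + u"
      then have "lookup (single j (Suc e)) i = lookup (single i 1 + u) i"
        by simp
      with False show False
        by (simp add: lookup_add lookup_single when_def)
    qed
    then have "single j (Suc e) \<notin> keys (X i * ?L ^ e)"
      using keys_single_mult[of "single i 1" 1 "?L ^ e"] by (auto simp: X_def mon_poly_def)
    then show ?thesis
      using False by (simp add: in_keys_iff)
  qed
  then show ?case
    using assms by (simp add: sum_distrib_right lookup_sum)
qed (simp add: lookup_one)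

lemma trunc_mdvd: "mdvd (trunc j s) s"
  by (simp add: mdvd_iff lookup_trunc)

lemma trunc_split:
  assumes "s \<in> monomials j" "j \<ge> 1"
  shows "s = trunc (j - 1) s + single j (lookup s j)"
proof (rule poly_mapping_eqI)
  fix i
  show "lookup s i = lookup (trunc (j - 1) s + single j (lookup s j)) i"
    using assms(2) lookup_monomials_eq_0[OF assms(1), of i]
    by (cases "i = j") (auto simp: lookup_add lookup_trunc lookup_single when_def)
qed

lemma mdeg_trunc_split:
  assumes "s \<in> monomials j" "j \<ge> 1"
  shows "mdeg s = mdeg (trunc (j - 1) s) + lookup s j"
  by (subst trunc_split[OF assms]) (simp add: mdeg_add)

section \<open>Membership of the \<open>g_s\<close> in the ideal\<close>

context ci
begin

lemma ideal_ideal_I: "ideal (ideal_I n m k :: ('a::comm_ring_1) mpol set) (poly_ring n)"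
  and X_power_in_ideal_I: "i \<in> {1..n} \<Longrightarrow> X i ^ m i \<in> (ideal_I n m k :: 'a mpol set)"
  and sum_X_power_in_ideal_I: "(\<Sum>i=1..n. X i) ^ k \<in> (ideal_I n m k :: 'a mpol set)"
proof -
  let ?S = "{X i ^ m i | i. i \<in> {1..n}} \<union> {(\<Sum>i=1..n. X i) ^ k} :: 'a mpol set"
  have S: "?S \<subseteq> carrier (poly_ring n)"
  proof
    fix p assume "p \<in> ?S"
    then consider i where "i \<in> {1..n}" "p = X i ^ m i" | "p = (\<Sum>i=1..n. X i) ^ k"
      by blast
    then show "p \<in> carrier (poly_ring n)"
      unfolding carrier_poly_ring
      by cases (simp_all only: keys_power_monomials keys_sum_monomials keys_X_monomials)
  qed
  show "ideal (ideal_I n m k :: 'a mpol set) (poly_ring n)"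
    unfolding ideal_I_def by (rule ideal_Idl[OF S])
  show "i \<in> {1..n} \<Longrightarrow> X i ^ m i \<in> (ideal_I n m k :: 'a mpol set)"
    "(\<Sum>i=1..n. X i) ^ k \<in> (ideal_I n m k :: 'a mpol set)"
    unfolding ideal_I_def using Idl_self[OF S] by blast+
qed

lemma int_sum_m:
  "j \<le> Suc n \<Longrightarrow> int (\<Sum>i=1..<j. m i - 1) = (\<Sum>i=1..<j. int (m i) - 1)"
  unfolding of_nat_sum using m_ge_2 by (intro sum.cong) (force simp: of_nat_diff)+

text \<open>With \<open>s'\<close> the part of \<open>s\<close> below \<open>x_j\<close>, the
  vanishing height says that \<open>2 deg s' + s_j\<close> is the right-hand side, and
  \<open>deg s = deg s' + s_j\<close>.\<close>

lemma crit_degrees: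
  assumes j: "j \<in> {1..n}" and s: "s \<in> crit n m k j"
  shows "mdeg s + mdeg (trunc (j - 1) s) = k + (\<Sum>i=1..<j. m i - 1)"
proof -
  have "s \<in> monomials j" "height j s = 0" "j \<ge> 1"
    using s j unfolding crit_iff[OF j] by auto
  moreover have "{1..j - 1} = {1..<j}"
    using j by auto
  ultimately have "int (mdeg s + mdeg (trunc (j - 1) s)) = int k + (\<Sum>i=1..<j. int (m i) - 1)"
    using mdeg_trunc_split[of s j] by (simp add: mdeg_trunc height_def)
  also have "\<dots> = int (k + (\<Sum>i=1..<j. m i - 1))"
    using int_sum_m[of j] j by simp
  finally have "int (mdeg s + mdeg (trunc (j - 1) s)) = int (k + (\<Sum>i=1..<j. m i - 1))" .
  then show ?thesis
    by linarith
qed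

text \<open>Each \<open>gfactor\<close> is split as \<open>Q i * mexp (X i)\<close>; the
  exponentials combine to that of the sum of all variables, and modulo the ideal the
  \<open>Q i\<close> have bounded degree in the series variable.\<close>

lemma taylor_coefficient_in_ideal:
  fixes s :: mon
  assumes j: "j \<in> {1..n}" and s: "s \<in> crit n m k j"
  shows "fps_nth ((\<Prod>i=1..<j. gfactor m s i) * mexp (\<Sum>i=j..n. X i)) (mdeg s) \<in> (ideal_I n m k :: ('a::field_char_0) mpol set)"
proof -
  let ?I = "ideal_I n m k :: 'a mpol set"
  define Q :: "nat \<Rightarrow> 'a mpol fps" where "Q i = gfactor m s i * mexp (- X i)" for i
  let ?ell = "\<Sum>i=1..n. X i :: 'a mpol"
  have I: "ideal ?I (poly_ring n)"
    by (rule ideal_ideal_I)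
  have s_lt: "lookup s i < m i" if "i \<in> {1..n}" for i
    using s that unfolding crit_iff[OF j] m_free_def by blast
  have Q: "Q i * mexp (X i) = gfactor m s i" for i
    unfolding Q_def mult.assoc by (simp add: mexp_0 flip: mexp_add)
  have "(\<Prod>i=1..<j. gfactor m s i) = (\<Prod>i=1..<j. Q i) * mexp (\<Sum>i=1..<j. X i)"
    by (simp add: mexp_sum Q flip: prod.distrib)
  moreover have "?ell = (\<Sum>i=1..<j. X i) + (\<Sum>i=j..n. X i)"
  proof -
    have "{1..n} = {1..<j} \<union> {j..n}"
      using j by auto
    then show ?thesis
      by (simp only:) (rule sum.union_disjoint; auto)
  qed
  ultimately have eq: "(\<Prod>i=1..<j. gfactor m s i) * mexp (\<Sum>i=j..n. X i) = (\<Prod>i=1..<j. Q i) * mexp ?ell"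
    by (simp add: mexp_add mult.assoc)
  have keysQ: "keys (fps_nth (Q i) c) \<subseteq> monomials n" if "i \<in> {1..<j}" for i c
  proof -
    have Xi: "keys (- X i :: 'a mpol) \<subseteq> monomials n"
      using keys_X_monomials[of i n] that j by (simp add: keys_uminus)
    have "keys (fps_nth (gfactor m s i) b :: 'a mpol) \<subseteq> monomials n" for b
      using single_in_monomials[of i n b] that j by (simp add: gfactor_nth)
    moreover have "keys (fps_nth (mexp (- X i)) b :: 'a mpol) \<subseteq> monomials n" for b
      unfolding mexp_nth by (intro keys_mult_monomials keys_power_monomials Xi) (simp add: zero_in_monomials)
    ultimately show ?thesis
      unfolding Q_def fps_mult_nth by (intro keys_sum_monomials keys_mult_monomials)
  qed
  \<comment> \<open>Two ranges: below \<open>m i\<close> the coefficient vanishes by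
    \<open>gfactor_mexp_nth\<close>, from \<open>m i\<close> on it is a multiple of a
    generator.\<close>
  have Q_high: "fps_nth (Q i) c \<in> ?I" if i: "i \<in> {1..<j}" and c: "c > m i - 1 - lookup s i" for i c
  proof (cases "c < m i")
    case True
    have "lookup s i < m i"
      using s_lt[of i] i j by simp
    with True c have "fps_nth (Q i) c = 0"
      unfolding Q_def by (intro gfactor_mexp_nth) auto
    then show ?thesis
      using ideal_zero_closed[OF I] by simp
  next
    case False
    \<comment> \<open>Both factors involve only \<open>x_i\<close>, and the degrees \<open>b\<close>
      and \<open>c - b\<close> add up to \<open>c\<close>.\<close>
    have eq: "t = single i c" if "t \<in> keys (fps_nth (Q i) c)" for t
    proof -
      have mX: "- X i = (single (single i 1) (- 1) :: 'a mpol)"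
        by (simp add: X_def mon_poly_def single_uminus)
      have "t \<in> (\<Union>b\<in>{0..c}. keys (fps_nth (gfactor m s i) b * fps_nth (mexp (- X i)) (c - b) :: 'a mpol))"
        using that unfolding Q_def fps_mult_nth by (rule subsetD[OF keys_sum_subset])
      then obtain b where "b \<le> c" "t \<in> keys (fps_nth (gfactor m s i) b * fps_nth (mexp (- X i)) (c - b) :: 'a mpol)"
        by auto
      then show ?thesis
        unfolding gfactor_nth mexp_nth mX single_single_power
        by (auto simp: mult_single simp flip: single_add split: if_splits)
    qed
    have "\<exists>i\<in>{1..n}. m i \<le> lookup t i" if "t \<in> keys (fps_nth (Q i) c)" for t
      using False i j unfolding eq[OF that] by (intro bexI[of _ i]) auto
    then show ?thesis
      by (intro keys_multiples_in_ideal[OF I X_power_in_ideal_I] keysQ i)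
  qed
  have prodQ: "keys (fps_nth (\<Prod>i=1..<j. Q i) N) \<subseteq> monomials n"
    "N > (\<Sum>i=1..<j. m i - 1 - lookup s i) \<Longrightarrow> fps_nth (\<Prod>i=1..<j. Q i) N \<in> ?I" for N
    using fps_prod_nth_in_ideal[OF I finite_atLeastLessThan keysQ Q_high] by simp_all
  have kell: "keys (?ell ^ e) \<subseteq> monomials n" for e
    by (intro keys_power_monomials keys_sum_monomials keys_X_monomials)
  have mexp_keys: "keys (fps_nth (mexp ?ell) c) \<subseteq> monomials n" for c
    unfolding mexp_nth by (intro keys_mult_monomials kell) (simp add: zero_in_monomials)
  have mexp_high: "fps_nth (mexp ?ell) c \<in> ?I" if "c \<ge> k" for c
  proof -
    have "keys (single 0 (1 / fact c) * ?ell ^ (c - k)) \<subseteq> monomials n"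
      by (intro keys_mult_monomials kell) (simp add: zero_in_monomials)
    then have "single 0 (1 / fact c) * ?ell ^ (c - k) * ?ell ^ k \<in> ?I"
      by (intro ideal_mult_closed[OF I] sum_X_power_in_ideal_I)
    then show ?thesis
      using that by (simp add: mexp_nth mult.assoc flip: power_add)
  qed
  have "(\<Sum>i=1..<j. m i - 1 - lookup s i) + (\<Sum>i=1..<j. lookup s i) = (\<Sum>i=1..<j. m i - 1)"
    unfolding sum.distrib[symmetric]
  proof (rule sum.cong)
    fix i assume "i \<in> {1..<j}"
    then show "m i - 1 - lookup s i + lookup s i = m i - 1"
      using s_lt[of i] j by simp
  qed simp
  moreover have "{1..j - 1} = {1..<j}"
    using j by auto
  \<comment> \<open>The degree of \<open>s\<close> exceeds the degree bound for the product of the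
    \<open>Q i\<close> by exactly \<open>k\<close>. So in each summand below, either the exponential
    contributes at least \<open>k\<close> factors or the product of the \<open>Q i\<close> is beyond
    its bound.\<close>
  ultimately have deg: "mdeg s = k + (\<Sum>i=1..<j. m i - 1 - lookup s i)"
    using crit_degrees[OF j s] by (simp add: mdeg_trunc)
  have "(\<Sum>c=0..mdeg s. fps_nth (\<Prod>i=1..<j. Q i) c * fps_nth (mexp ?ell) (mdeg s - c)) \<in> ?I"
  proof (rule ideal_sum_closed[OF I])
    fix c
    show "fps_nth (\<Prod>i=1..<j. Q i) c * fps_nth (mexp ?ell) (mdeg s - c) \<in> ?I"
    proof (cases "mdeg s - c \<ge> k")
      case True
      then show ?thesis
        by (intro ideal_mult_closed[OF I] mexp_high prodQ(1))
    next
      case False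
      then have "fps_nth (mexp ?ell) (mdeg s - c) * fps_nth (\<Prod>i=1..<j. Q i) c \<in> ?I"
        using deg by (intro ideal_mult_closed[OF I] mexp_keys prodQ(2)) simp
      then show ?thesis
        by (simp add: mult.commute)
    qed
  qed
  then show ?thesis
    unfolding eq by (simp add: fps_mult_nth)
qed

text \<open>Without deletion, \<open>g_s\<close> is the factorial of \<open>lookup s j\<close> times
  the coefficient \<open>F\<close> of the preceding lemma; the deleted terms are multiples of the
  powers \<open>X i ^ m i\<close>.\<close>

lemma g_poly_in_ideal_I:
  assumes j: "j \<in> {1..n}" and s: "s \<in> crit n m k j"
  shows "g_poly n m j s \<in> (ideal_I n m k :: ('a::field_char_0) mpol set)"
proof -
  let ?I = "ideal_I n m k :: 'a mpol set"
  let ?s' = "trunc (j - 1) s"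
  let ?L = "\<Sum>i=j..n. X i :: 'a mpol"
  let ?del = "delete_in (Idl\<^bsub>poly_ring n\<^esub> {X i ^ m i | i. i \<in> {j..n}})"
  let ?c = "\<lambda>t. \<Prod>i=1..<j. gcoeff m s i (lookup t i) :: 'a"
  have I: "ideal ?I (poly_ring n)"
    by (rule ideal_ideal_I)
  have j1: "j \<ge> 1"
    using j by simp
  have kL: "keys (?L ^ e) \<subseteq> monomials n" for e
    using j by (intro keys_power_monomials keys_sum_monomials keys_X_monomials) auto
  define F where "F = fps_nth ((\<Prod>i=1..<j. gfactor m s i) * mexp ?L) (mdeg s)"
  have F: "F = (\<Sum>t | mdvd t ?s'. single t (?c t) * (single 0 (1 / fact (mdeg s - mdeg t)) * ?L ^ (mdeg s - mdeg t)))"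
  proof -
    have "F = (\<Sum>t | mdvd t ?s'. fps_nth (fps_const (single t (?c t)) * (fps_X ^ mdeg t * mexp ?L)) (mdeg s))"
      using j unfolding F_def by (subst prod_gfactor) (simp_all add: sum_distrib_right fps_sum_nth mult.assoc)
    also have "\<dots> = (\<Sum>t | mdvd t ?s'. single t (?c t) * (single 0 (1 / fact (mdeg s - mdeg t)) * ?L ^ (mdeg s - mdeg t)))"
    proof (rule sum.cong)
      fix t assume "t \<in> {t. mdvd t ?s'}"
      then have "mdeg t \<le> mdeg s"
        using mdvd_trans trunc_mdvd mdeg_le by blast
      then show "fps_nth (fps_const (single t (?c t)) * (fps_X ^ mdeg t * mexp ?L)) (mdeg s)
          = single t (?c t) * (single 0 (1 / fact (mdeg s - mdeg t)) * ?L ^ (mdeg s - mdeg t))"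
        by (simp add: fps_X_power_mult_nth mexp_nth)
    qed simp
    finally show ?thesis .
  qed
  have "single 0 (fact (lookup s j)) * F = (\<Sum>t | mdvd t ?s'. single t (lam m j s t) * ?L ^ (mdeg s - mdeg t))"
    unfolding F sum_distrib_left
  proof (rule sum.cong)
    fix t
    have "single 0 (fact (lookup s j)) * (single t (?c t) * single 0 (1 / fact (mdeg s - mdeg t))) = single t (lam m j s t :: 'a)"
      by (simp add: mult_single lam_def gcoeff_def mult.commute)
    moreover have "a * (b * (c * x)) = (a * (b * c)) * x" for a b c x :: "'a mpol"
      by (simp only: mult.assoc)
    ultimately show "single 0 (fact (lookup s j)) * (single t (?c t) * (single 0 (1 / fact (mdeg s - mdeg t)) * ?L ^ (mdeg s - mdeg t)))
        = single t (lam m j s t) * ?L ^ (mdeg s - mdeg t)"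
      by (simp only:)
  qed simp
  then have "g_poly n m j s = single 0 (fact (lookup s j)) * F +
      (\<Sum>t | mdvd t ?s'. single t (lam m j s t) * (?del (?L ^ (mdeg s - mdeg t)) - ?L ^ (mdeg s - mdeg t)))"
    by (simp add: g_poly_def right_diff_distrib sum_subtractf)
  moreover have "F \<in> ?I"
    unfolding F_def by (rule taylor_coefficient_in_ideal[OF j s])
  then have "single 0 (fact (lookup s j)) * F \<in> ?I"
    by (intro ideal_mult_closed[OF I]) (simp add: zero_in_monomials)
  moreover have "(\<Sum>t | mdvd t ?s'. single t (lam m j s t) * (?del (?L ^ (mdeg s - mdeg t)) - ?L ^ (mdeg s - mdeg t))) \<in> ?I"
  proof (rule ideal_sum_closed[OF I])
    fix t assume t: "t \<in> {t. mdvd t ?s'}"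
    have "?s' \<in> monomials n"
      using trunc_in_monomials monomials_mono[of "j - 1" n] j by force
    then have "t \<in> monomials n"
      using t mdvd_monomials by blast
    then have "keys (single t (lam m j s t) :: 'a mpol) \<subseteq> monomials n"
      by simp
    moreover have "?del (?L ^ e) - ?L ^ e \<in> ?I" for e
    proof (rule keys_multiples_in_ideal[OF I X_power_in_ideal_I])
      have l: "lookup (?del (?L ^ e) - ?L ^ e) u = (if \<exists>i\<in>{j..n}. m i \<le> lookup u i then - lookup (?L ^ e) u else 0)" for u
        unfolding lookup_minus lookup_delete_in[OF j1 kL] by simp
      show "keys (?del (?L ^ e) - ?L ^ e) \<subseteq> monomials n"
      proof
        fix u assume "u \<in> keys (?del (?L ^ e) - ?L ^ e)"
        then have "u \<in> keys (?L ^ e)"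
          unfolding in_keys_iff l by (simp split: if_splits)
        with kL show "u \<in> monomials n"
          by blast
      qed
      fix u assume "u \<in> keys (?del (?L ^ e) - ?L ^ e)"
      then have "\<exists>i\<in>{j..n}. m i \<le> lookup u i"
        unfolding in_keys_iff l by (simp split: if_splits)
      then show "\<exists>i\<in>{1..n}. m i \<le> lookup u i"
        using j by force
    qed
    ultimately show "single t (lam m j s t) * (?del (?L ^ (mdeg s - mdeg t)) - ?L ^ (mdeg s - mdeg t)) \<in> ?I"
      by (intro ideal_mult_closed[OF I])
  qed
  ultimately show ?thesis
    using ideal_add_closed[OF I] by simp
qed

section \<open>Monomials and leading coefficient of \<open>g_s\<close>\<close>

lemma keys_g_poly_term:
  assumes j: "j \<in> {1..n}"
    and t: "t \<in> keys (single u c * delete_in (Idl\<^bsub>poly_ring n\<^esub> {X i ^ m i | i. i \<in> {j..n}}) ((\<Sum>i=j..n. X i) ^ e) :: ('a::field_char_0) mpol)"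
  obtains y where "t = u + y" "keys y \<subseteq> {j..n}" "mdeg y = e" "\<And>i. i \<in> {j..n} \<Longrightarrow> lookup y i < m i"
proof -
  let ?L = "\<Sum>i=j..n. X i :: 'a mpol"
  have kL: "keys (?L ^ e) \<subseteq> monomials n"
    using j by (intro keys_power_monomials keys_sum_monomials keys_X_monomials) auto
  obtain y where y: "t = u + y" "y \<in> keys (delete_in (Idl\<^bsub>poly_ring n\<^esub> {X i ^ m i | i. i \<in> {j..n}}) (?L ^ e))"
    using keys_single_mult t by blast
  have "j \<ge> 1"
    using j by simp
  from y(2) have "lookup (?L ^ e) y \<noteq> 0" "\<not> (\<exists>i\<in>{j..n}. m i \<le> lookup y i)"
    unfolding in_keys_iff lookup_delete_in[OF \<open>j \<ge> 1\<close> kL] by (simp_all split: if_splits)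
  then show thesis
    using that[OF y(1)] keys_sum_X_power[of y "{j..n}" e] by (auto simp: in_keys_iff not_le)
qed

lemma keys_g_poly:
  assumes j: "j \<in> {1..n}" and t: "t \<in> keys (g_poly n m j s :: ('a::field_char_0) mpol)"
  obtains u y where "t = u + y" "mdvd u (trunc (j - 1) s)" "keys y \<subseteq> {j..n}" "mdeg y = mdeg s - mdeg u"
    "\<And>i. i \<in> {j..n} \<Longrightarrow> lookup y i < m i"
proof -
  obtain u where u: "mdvd u (trunc (j - 1) s)" "t \<in> keys (single u (lam m j s u) *
      delete_in (Idl\<^bsub>poly_ring n\<^esub> {X i ^ m i | i. i \<in> {j..n}}) ((\<Sum>i=j..n. X i) ^ (mdeg s - mdeg u)) :: 'a mpol)"
    using subsetD[OF keys_sum_subset t[unfolded g_poly_def]] by blast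
  from u(1) keys_g_poly_term[OF j u(2)] that show thesis
    by metis
qed

text \<open>The cofactors involve only \<open>x_j, ..., x_n\<close>, so \<open>s\<close> occurs only
  in the summand of its own truncation, where the scalar \<open>lam\<close> is 1.\<close>

lemma lookup_g_poly_crit:
  assumes j: "j \<in> {1..n}" and s: "s \<in> crit n m k j"
  shows "lookup (g_poly n m j s) s = (1 :: 'a::field_char_0)"
proof -
  let ?s' = "trunc (j - 1) s"
  let ?f = "\<lambda>t. single t (lam m j s t) *
    delete_in (Idl\<^bsub>poly_ring n\<^esub> {X i ^ m i | i. i \<in> {j..n}}) ((\<Sum>i=j..n. X i) ^ (mdeg s - mdeg t)) :: 'a mpol"
  have sj: "s \<in> monomials j" "j \<ge> 1" "lookup s j < m j"
    using s j unfolding crit_iff[OF j] by (auto simp: m_free_def)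
  have kL: "keys ((\<Sum>i=j..n. X i) ^ e :: 'a mpol) \<subseteq> monomials n" for e
    using j by (intro keys_power_monomials keys_sum_monomials keys_X_monomials) auto
  have other: "lookup (?f t) s = 0" if "mdvd t ?s'" "t \<noteq> ?s'" for t
  proof (rule ccontr)
    assume "lookup (?f t) s \<noteq> 0"
    then have "s \<in> keys (?f t)"
      by (simp add: in_keys_iff)
    then obtain y where y: "s = t + y" "keys y \<subseteq> {j..n}"
      by (rule keys_g_poly_term[OF j])
    have "t = ?s'"
    proof (rule poly_mapping_eqI)
      fix i
      have "lookup t i \<le> lookup ?s' i"
        using that(1) by (simp add: mdvd_iff)
      moreover have "lookup y i = 0" if "i < j"
        using y(2) that by (meson atLeastAtMost_iff in_keys_iff not_less subsetD)
      ultimately show "lookup t i = lookup ?s' i"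
        using y(1) by (auto simp: lookup_trunc lookup_add split: if_splits)
    qed
    with that(2) show False
      by simp
  qed
  have "lookup (g_poly n m j s) s = (\<Sum>t | mdvd t ?s'. lookup (?f t) s)"
    by (simp add: g_poly_def lookup_sum)
  also have "\<dots> = (\<Sum>t\<in>{?s'}. lookup (?f t) s)"
    by (rule sum.mono_neutral_right) (use other finite_mdvd mdvd_refl in auto)
  also have "\<dots> = lookup (?f ?s') (?s' + single j (lookup s j))"
    using trunc_split[OF sj(1,2)] by simp
  also have "\<dots> = lam m j s ?s'"
  proof -
    \<comment> \<open>The monomial survives deletion: \<open>s\<close> is \<open>m\<close>-free at
      \<open>j\<close>, and at the other variables the exponent 0 lies below
      \<open>m i\<close>.\<close>
    have "\<not> m i \<le> lookup (single j (lookup s j)) i" if "i \<in> {j..n}" for i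
      using sj(3) m_ge_2[of i] that sj(2) by (auto simp: lookup_single when_def)
    then have free: "\<not> (\<exists>i\<in>{j..n}. m i \<le> lookup (single j (lookup s j)) i)"
      by blast
    show ?thesis
      unfolding lookup_single_mult lookup_delete_in[OF sj(2) kL] if_not_P[OF free]
      using j mdeg_trunc_split[OF sj(1,2)] by (simp add: lookup_sum_X_power)
  qed
  also have "\<dots> = 1"
  proof -
    have "(\<Prod>i=1..<j. fact (lookup s i) / fact (lookup ?s' i) *
        of_nat ((m i - lookup ?s' i - 1) choose (lookup s i - lookup ?s' i))) = (1 :: 'a)"
      by (rule prod.neutral) (auto simp: lookup_trunc)
    then show ?thesis
      using mdeg_trunc_split[OF sj(1,2)] by (simp add: lam_def)
  qed
  finally show ?thesis .
qed

end

subsection \<open>Standard monomials and dimension count\<close>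

context mon_order
begin

text \<open>An arbitrary monomial ordering need not compare degrees first, but in equal degree the
  factors can be exchanged one variable at a time.\<close>

lemma mdeg_eq_le:
  assumes vars: "\<And>a b. a \<in> keys s \<Longrightarrow> b \<in> keys t \<Longrightarrow> (single a 1, single b 1) \<in> r"
    and mons: "s \<in> monomials n" "t \<in> monomials n" and deg: "mdeg s = mdeg t"
  shows "(s, t) \<in> r"
  using assms
proof (induction "mdeg s" arbitrary: s t)
  case 0
  then have "s = 0" "t = 0"
    by (metis mdeg_eq_0_iff)+
  then show ?case
    using le_refl zero_in_monomials by simp
next
  case (Suc d)
  have ex: "\<exists>a u'. a \<in> keys u \<and> u = single a 1 + u'" if deg: "mdeg u = Suc d" for u
  proof -
    have "u \<noteq> 0"
      using deg by auto
    then obtain a where a: "a \<in> keys u"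
      by (metis keys_eq_empty all_not_in_conv)
    then have "mdvd (single a 1) u"
      by (simp add: single_mdvd_iff in_keys_iff Suc_le_eq)
    with a show ?thesis
      unfolding mdvd_def by blast
  qed
  obtain a s' where s: "a \<in> keys s" "s = single a 1 + s'"
    using ex[of s] Suc.hyps(2) by auto
  obtain b t' where t: "b \<in> keys t" "t = single b 1 + t'"
    using ex[of t] Suc.hyps(2) Suc.prems(4) by auto
  have sub: "keys s' \<subseteq> keys s" "keys t' \<subseteq> keys t"
    by (auto simp: s(2) t(2) in_keys_iff lookup_add)
  have mons: "s' \<in> monomials n" "t' \<in> monomials n" "single a 1 \<in> monomials n"
    using sub Suc.prems(2,3) s(1) by (auto simp: monomials_def)
  have "(s', t') \<in> r"
  proof (rule Suc.hyps(1))
    show "d = mdeg s'" "mdeg s' = mdeg t'"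
      using Suc.hyps(2) Suc.prems(4) by (auto simp: s(2) t(2) mdeg_add)
  qed (use sub Suc.prems(1) mons in auto)
  \<comment> \<open>The chain is \<open>x_a s'\<close>, then \<open>x_a t'\<close>, then
    \<open>x_b t'\<close>.\<close>
  then have "(s' + single a 1, t' + single a 1) \<in> r"
    using mons by (intro le_add)
  moreover have "(single a 1 + t', single b 1 + t') \<in> r"
    using Suc.prems(1) s(1) t(1) mons by (intro le_add) auto
  ultimately show ?case
    unfolding s(2) t(2) using le_trans by (metis add.commute)
qed

end

section \<open>Linear algebra over the coefficient field, with scalars acting as constant
  polynomials\<close>

interpretation mpol: vector_space "\<lambda>(c::'a::field) (p :: 'a mpol). single 0 c * p"
  by unfold_locales (simp_all add: distrib_left distrib_right single_add mult_single flip: mult.assoc)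

lemma lookup_scale: "lookup (single 0 c * p) t = c * lookup (p :: ('a::comm_ring_1) mpol) t"
  using lookup_single_mult[of 0 c p t] by simp

text \<open>In a vanishing combination let \<open>v\<close> be the greatest index with nonzero
  coefficient. At the monomial \<open>v\<close> only the term of \<open>f v\<close>
  contributes.\<close>

lemma (in mon_order) independent_distinct_initial:
  fixes f :: "mon \<Rightarrow> ('a::field) mpol"
  assumes B: "finite B" "B \<subseteq> monomials n"
    and f: "\<And>v. v \<in> B \<Longrightarrow> v \<in> keys (f v)" "\<And>u v. v \<in> B \<Longrightarrow> u \<in> keys (f v) \<Longrightarrow> (u, v) \<in> r"
  shows "inj_on f B" "mpol.independent (f ` B)"
proof -
  show inj: "inj_on f B"
    by (rule inj_onI) (metis f le_antisym)
  show "mpol.independent (f ` B)"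
  proof
    assume "mpol.dependent (f ` B)"
    then obtain c where c: "\<exists>p\<in>f ` B. c p \<noteq> 0" "(\<Sum>p\<in>f ` B. single 0 (c p) * p) = 0"
      using mpol.dependent_finite[of "f ` B"] B(1) by auto
    define S where "S = {v \<in> B. c (f v) \<noteq> 0}"
    have "finite S" "S \<noteq> {}" "S \<subseteq> monomials n"
      using B c(1) by (auto simp: S_def)
    from ex_greatest[OF this] obtain v where v: "v \<in> S" "\<And>w. w \<in> S \<Longrightarrow> (w, v) \<in> r"
      by blast
    have other: "c (f w) * lookup (f w) v = 0" if "w \<in> B - {v}" for w
    proof (cases "w \<in> S \<and> v \<in> keys (f w)")
      case True
      then have "w = v"
        using v(2) f(2)[of w v] that le_antisym by blast
      with that show ?thesis
        by simp
    next
      case False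
      with that show ?thesis
        by (auto simp: S_def in_keys_iff)
    qed
    have "0 = lookup (\<Sum>w\<in>B. single 0 (c (f w)) * f w) v"
      using c(2) by (simp add: sum.reindex[OF inj])
    also have "\<dots> = (\<Sum>w\<in>B. c (f w) * lookup (f w) v)"
      by (simp add: lookup_sum lookup_scale)
    also have "\<dots> = (\<Sum>w\<in>{v}. c (f w) * lookup (f w) v)"
      using B(1) v(1) other by (intro sum.mono_neutral_right) (auto simp: S_def)
    also have "\<dots> \<noteq> 0"
      using v(1) f(1)[of v] by (simp add: S_def in_keys_iff)
    finally show False
      by simp
  qed
qed

text \<open>Models passing to the quotient by the powers \<open>X i ^ m i\<close> and then to its
  component of degree \<open>d\<close>, without leaving the polynomial ring.\<close>

definition proj :: "nat \<Rightarrow> (nat \<Rightarrow> nat) \<Rightarrow> nat \<Rightarrow> ('a::comm_ring_1) mpol \<Rightarrow> 'a mpol" where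
  "proj n m d p = (\<Sum>t\<in>m_free_mons n m d. single t (lookup p t))"

lemma lookup_proj: "lookup (proj n m d p) t = (if t \<in> m_free_mons n m d then lookup p t else 0)"
  by (simp add: proj_def lookup_sum lookup_single when_def finite_m_free_mons)

lemma proj_add: "proj n m d (p + q) = proj n m d p + proj n m d q"
  by (rule poly_mapping_eqI) (simp add: lookup_proj lookup_add)

lemma proj_sum: "proj n m d (sum f A) = (\<Sum>x\<in>A. proj n m d (f x))"
  by (rule poly_mapping_eqI) (simp add: lookup_proj lookup_sum)

lemma proj_scale: "proj n m d (single 0 c * p) = single 0 c * proj n m d p"
  by (rule poly_mapping_eqI) (simp add: lookup_proj lookup_scale)

section \<open>Upper bound for the ideal in one degree, and standardness of the lower terms of
  \<open>g_s\<close>\<close>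

context ci
begin

text \<open>The polynomials of the stated form are themselves an ideal containing the generators,
  because multiples of monomials that are not \<open>m\<close>-free are not \<open>m\<close>-free
  either.\<close>

lemma ideal_I_decompose:
  assumes p: "p \<in> (ideal_I n m k :: ('a::comm_ring_1) mpol set)"
  obtains q b where "p = q + b * (\<Sum>i=1..n. X i) ^ k" "keys b \<subseteq> monomials n"
    "\<And>t. t \<in> keys q \<Longrightarrow> \<not> m_free n m t"
proof -
  let ?l = "(\<Sum>i=1..n. X i) ^ k :: 'a mpol"
  define J where "J = {q + b * ?l | q b. keys b \<subseteq> monomials n \<and> keys q \<subseteq> monomials n \<and>
    (\<forall>t\<in>keys q. \<not> m_free n m t)}"
  have l: "keys ?l \<subseteq> monomials n"
    by (intro keys_power_monomials keys_sum_monomials keys_X_monomials)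
  have "ideal J (poly_ring n)"
    unfolding ideal_poly_ring_iff
  proof (intro conjI allI ballI impI)
    show "J \<subseteq> carrier (poly_ring n)"
    proof
      fix x assume "x \<in> J"
      then obtain q b where "x = q + b * ?l" "keys b \<subseteq> monomials n" "keys q \<subseteq> monomials n"
        unfolding J_def by blast
      then show "x \<in> carrier (poly_ring n)"
        using l by (simp only: carrier_poly_ring keys_add_monomials keys_mult_monomials)
    qed
    show "0 \<in> J"
      unfolding J_def by (intro CollectI exI[of _ 0]) simp
  next
    fix x y assume "x \<in> J" "y \<in> J"
    then obtain q b q' b' where xy: "x = q + b * ?l" "y = q' + b' * ?l"
      and kb: "keys b \<subseteq> monomials n" "keys b' \<subseteq> monomials n"
      and kq: "keys q \<subseteq> monomials n" "keys q' \<subseteq> monomials n"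
      "\<forall>t\<in>keys q. \<not> m_free n m t" "\<forall>t\<in>keys q'. \<not> m_free n m t"
      unfolding J_def by blast
    have "x + y = (q + q') + (b + b') * ?l"
      by (simp add: xy algebra_simps)
    moreover have "\<forall>t\<in>keys (q + q'). \<not> m_free n m t"
      using kq(3,4) Poly_Mapping.keys_add[of q q'] by blast
    ultimately show "x + y \<in> J"
      unfolding J_def using keys_add_monomials kb kq(1,2) by blast
  next
    fix a x :: "'a mpol" assume "x \<in> J" and a: "keys a \<subseteq> monomials n"
    then obtain q b where x: "x = q + b * ?l" and kb: "keys b \<subseteq> monomials n"
      and kq: "keys q \<subseteq> monomials n" "\<forall>t\<in>keys q. \<not> m_free n m t"
      unfolding J_def by blast
    have "a * x = a * q + (a * b) * ?l"
      by (simp add: x algebra_simps)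
    moreover have "\<not> m_free n m t" if t: "t \<in> keys (a * q)" for t
    proof -
      obtain v w where "t = v + w" "w \<in> keys q"
        using t keys_mult[of a q] by blast
      then show ?thesis
        using kq(2) m_free_mdvd[of n m t w] mdvd_add[of w v] by (auto simp: add.commute)
    qed
    ultimately show "a * x \<in> J"
      unfolding J_def using keys_mult_monomials[OF a] kb kq(1) by blast
  qed
  moreover have "{X i ^ m i | i. i \<in> {1..n}} \<union> {?l} \<subseteq> J"
  proof
    fix x assume "x \<in> {X i ^ m i | i. i \<in> {1..n}} \<union> {?l}"
    then consider i where "i \<in> {1..n}" "x = X i ^ m i" | "x = ?l"
      by blast
    then show "x \<in> J"
    proof cases
      case 1
      then have "keys x \<subseteq> monomials n" "\<forall>t\<in>keys x. \<not> m_free n m t"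
        by (auto simp: X_power single_in_monomials m_free_def simp del: atLeastAtMost_iff intro!: bexI[of _ i])
      then show ?thesis
        unfolding J_def by (intro CollectI exI[of _ x] exI[of _ 0]) simp
    next
      case 2
      then show ?thesis
        unfolding J_def by (intro CollectI exI[of _ 0] exI[of _ 1]) (simp add: zero_in_monomials)
    qed
  qed
  ultimately have "ideal_I n m k \<subseteq> J"
    unfolding ideal_I_def by (rule Idl_minimal)
  with p have "p \<in> J"
    by blast
  then show thesis
    using that unfolding J_def by blast
qed

text \<open>The projection kills \<open>q\<close>, and \<open>b\<close> is expanded into its
  monomials \<open>u\<close>. This bounds the dimension by the number of \<open>m\<close>-free
  monomials of degree \<open>d - k\<close>.\<close>

lemma proj_ideal_I_in_span:
  assumes p: "p \<in> (ideal_I n m k :: ('a::field) mpol set)"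
  shows "proj n m d p \<in> mpol.span ((\<lambda>u. proj n m d (single u 1 * (\<Sum>i=1..n. X i) ^ k)) `
    {u \<in> monomials n. m_free n m u \<and> mdeg u + k = d})" (is "_ \<in> mpol.span (?g ` ?U)")
proof -
  let ?l = "(\<Sum>i=1..n. X i) ^ k :: 'a mpol"
  obtain q b where p: "p = q + b * ?l" and b: "keys b \<subseteq> monomials n"
    and q: "\<And>t. t \<in> keys q \<Longrightarrow> \<not> m_free n m t"
    using ideal_I_decompose[OF p] by blast
  have "proj n m d q = 0"
    using q by (intro poly_mapping_eqI) (auto simp: lookup_proj m_free_mons_def in_keys_iff)
  moreover have "b * ?l = (\<Sum>u\<in>keys b. single 0 (lookup b u) * (single u 1 * ?l))"
    by (subst poly_eq_sum[of b]) (simp add: sum_distrib_right mult_single flip: mult.assoc)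
  ultimately have eq: "proj n m d p = (\<Sum>u\<in>keys b. single 0 (lookup b u) * ?g u)"
    by (simp add: p proj_add proj_sum proj_scale)
  show ?thesis
    unfolding eq
  proof (intro mpol.span_sum mpol.span_scale)
    fix u assume u: "u \<in> keys b"
    show "?g u \<in> mpol.span (?g ` ?U)"
    proof (cases "u \<in> ?U")
      case True
      then show ?thesis
        by (intro mpol.span_base imageI)
    next
      case False
      \<comment> \<open>All monomials of this product are multiples of \<open>u\<close> of degree
        \<open>mdeg u + k\<close>, so for \<open>u\<close> outside the index set none survives the
        projection.\<close>
      have "t \<notin> keys (single u 1 * ?l)" if t: "t \<in> m_free_mons n m d" for t
      proof
        assume "t \<in> keys (single u 1 * ?l)"
        then obtain w where w: "t = u + w" "w \<in> keys ?l"
          using keys_single_mult by blast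
        then have "mdeg w = k"
          using keys_sum_X_power by blast
        then have "m_free n m u" "mdeg u + k = d"
          using t m_free_mdvd[of n m t u] mdvd_add by (auto simp: m_free_mons_def w mdeg_add)
        with False u b show False
          by blast
      qed
      then have "?g u = 0"
        by (intro poly_mapping_eqI) (auto simp: lookup_proj in_keys_iff)
      then show ?thesis
        using mpol.span_zero by simp
    qed
  qed
qed

text \<open>A monomial \<open>t = u + y\<close> of \<open>g_s\<close> has peaks before
  \<open>x_j\<close> no higher than those of \<open>s\<close>, hence negative. From
  \<open>x_j\<close> on, degree bounds make the peaks at most 0, with equality only for
  \<open>t = s\<close>.\<close>

lemma keys_g_poly_standard:
  assumes j: "j \<in> {1..n}" and s: "s \<in> crit n m k j"
    and t: "t \<in> keys (g_poly n m j s :: ('a::field_char_0) mpol)" "t \<noteq> s"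
  shows "standard t"
proof -
  let ?s' = "trunc (j - 1) s"
  obtain u y where uy: "t = u + y" "mdvd u ?s'" "keys y \<subseteq> {j..n}" "mdeg y = mdeg s - mdeg u"
    and y_lt: "\<And>i. i \<in> {j..n} \<Longrightarrow> lookup y i < m i"
    using keys_g_poly[OF j t(1)] by blast
  have sj: "s \<in> monomials j" "m_free n m s" "lookup s j < m j" "\<forall>l\<in>{1..<j}. height l s < 0"
    using s j unfolding crit_iff[OF j] by (auto simp: m_free_def)
  have u_mon: "u \<in> monomials (j - 1)"
    using uy(2) trunc_in_monomials mdvd_monomials by blast
  have u0: "lookup u i = 0" if "i \<ge> j" for i
    using lookup_monomials_eq_0[OF u_mon, of i] that j by auto
  have y0: "lookup y i = 0" if "i \<notin> {j..n}" for i
    using uy(3) that by (metis in_keys_iff subsetD)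
  have y_mon: "y \<in> monomials n"
    using uy(3) j by (force simp: monomials_def)
  have us: "mdvd u s"
    using uy(2) trunc_mdvd mdvd_trans by blast
  have t_mon: "t \<in> monomials n"
  proof -
    have "j - 1 \<le> n"
      using j by auto
    then have "u \<in> monomials n"
      using u_mon monomials_mono by blast
    then show ?thesis
      unfolding uy(1) using y_mon by (rule monomials_add)
  qed
  have t_free: "m_free n m t"
    unfolding m_free_def
  proof
    fix i assume i: "i \<in> {1..n}"
    show "lookup t i < m i"
    proof (cases "i < j")
      case True
      then have "lookup t i \<le> lookup s i"
        using us y0[of i] by (simp add: uy(1) lookup_add mdvd_iff)
      then show ?thesis
        using sj(2) i by (meson le_less_trans m_free_def)
    next
      case False
      then show ?thesis
        using u0[of i] y_lt[of i] i by (simp add: uy(1) lookup_add)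
    qed
  qed
  have "height l t < 0" if l: "l \<in> {1..n}" for l
  proof (cases "l < j")
    case True
    then have "height l t = height l u"
      using l y0 by (intro height_cong) (auto simp: uy(1) lookup_add)
    then show ?thesis
      using height_mono[OF us, of l] sj(4) True l by force
  next
    case False
    show ?thesis
    proof (rule ccontr)
      assume nonneg: "\<not> height l t < 0"
      define A where "A = (\<Sum>i=j..<l. int (lookup y i))"
      define M where "M = (\<Sum>i=j..<l. int (m i) - 1)"
      have low: "(\<Sum>i=1..<j. int (lookup t i)) = int (mdeg u)"
      proof -
        have "{1..j - 1} = {1..<j}"
          using j by auto
        moreover have "(\<Sum>i=1..<j. int (lookup t i)) = (\<Sum>i=1..<j. int (lookup u i))"
          using y0 by (intro sum.cong) (auto simp: uy(1) lookup_add)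
        ultimately show ?thesis
          by (simp add: mdeg_eq_sum[OF u_mon])
      qed
      have high: "(\<Sum>i=j..<l. int (lookup t i)) = A" "lookup t l = lookup y l"
        unfolding A_def using u0 False by (auto simp: uy(1) lookup_add intro!: sum.cong)
      have "(\<Sum>i=1..<l. int (lookup t i)) = int (mdeg u) + A"
        "(\<Sum>i=1..<l. int (m i) - 1) = (\<Sum>i=1..<j. int (m i) - 1) + M"
        unfolding low[symmetric] high(1)[symmetric] M_def using j False
        by (intro sum.atLeastLessThan_concat[symmetric]; simp)+
      then have h: "height l t = 2 * (int (mdeg u) + A) + int (lookup y l) - (int k + (\<Sum>i=1..<j. int (m i) - 1)) - M"
        by (simp add: height_def high(2))
      have K: "int (mdeg s) + int (mdeg ?s') = int k + (\<Sum>i=1..<j. int (m i) - 1)"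
      proof -
        have "j \<le> Suc n"
          using j by auto
        then show ?thesis
          unfolding of_nat_add[symmetric] crit_degrees[OF j s] by (simp only: of_nat_add int_sum_m)
      qed
      have "A + int (lookup y l) \<le> int (mdeg y)"
      proof -
        have "A + int (lookup y l) = (\<Sum>i=j..l. int (lookup y i))"
          unfolding A_def using False by (simp flip: atLeastLessThanSuc_atLeastAtMost)
        also have "\<dots> \<le> (\<Sum>i=1..n. int (lookup y i))"
          using j l by (intro sum_mono2) auto
        finally show ?thesis
          by (simp add: mdeg_eq_sum[OF y_mon])
      qed
      moreover have "int (mdeg y) = int (mdeg s) - int (mdeg u)"
        using uy(4) mdeg_le[OF us] by simp
      moreover have "int (mdeg u) \<le> int (mdeg ?s')"
        using mdeg_le[OF uy(2)] by simp
      moreover have AM: "A \<le> M"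
        unfolding A_def M_def
      proof (rule sum_mono)
        fix i assume "i \<in> {j..<l}"
        then show "int (lookup y i) \<le> int (m i) - 1"
          using y_lt[of i] l by simp
      qed
      \<comment> \<open>By \<open>h\<close> and \<open>K\<close> the height is the sum of
        \<open>mdeg u - mdeg ?s'\<close>, \<open>A - M\<close> and
        \<open>A + lookup y l - mdeg y\<close>, none of which is positive; so all three
        vanish.\<close>
      ultimately have "int (mdeg u) = int (mdeg ?s') \<and> A = M \<and> A + int (lookup y l) = int (mdeg y)"
        using nonneg unfolding h K[symmetric] by presburger
      then have eqs: "mdeg u = mdeg ?s'" "A = M" "A + int (lookup y l) = int (mdeg y)"
        by simp_all
      have "u = ?s'"
        using mdvd_mdeg_eq[OF uy(2)] eqs(1) by simp
      have deg_y: "mdeg y = lookup s j"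
        using uy(4) eqs(1) mdeg_trunc_split[OF sj(1)] j by simp
      have "lookup s j \<le> lookup y j"
      proof (cases "l = j")
        case True
        then show ?thesis
          using eqs(3) deg_y by (simp add: A_def)
      next
        case neq: False
        \<comment> \<open>Equality \<open>A = M\<close> forces the exponents of \<open>y\<close>
          between \<open>j\<close> and \<open>l\<close> to be maximal; in particular that of
          \<open>x_j\<close> is at least \<open>lookup s j\<close>.\<close>
        have "(\<Sum>i=Suc j..<l. int (lookup y i)) \<le> (\<Sum>i=Suc j..<l. int (m i) - 1)"
        proof (rule sum_mono)
          fix i assume "i \<in> {Suc j..<l}"
          then show "int (lookup y i) \<le> int (m i) - 1"
            using y_lt[of i] l by simp
        qed
        moreover have "A = int (lookup y j) + (\<Sum>i=Suc j..<l. int (lookup y i))"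
          "M = int (m j) - 1 + (\<Sum>i=Suc j..<l. int (m i) - 1)"
          unfolding A_def M_def using neq False by (simp_all add: sum.atLeast_Suc_lessThan)
        ultimately show ?thesis
          using eqs(2) sj(3) by linarith
      qed
      then have "single j (lookup s j) = y"
        by (intro mdvd_mdeg_eq) (simp_all add: single_mdvd_iff deg_y)
      with \<open>u = ?s'\<close> have "t = s"
        using uy(1) trunc_split[OF sj(1)] j by simp
      with t(2) show False
        by simp
    qed
  qed
  then show ?thesis
    using t_mon t_free by (simp add: standard_def)
qed

end

section \<open>Initial monomials and the reduced Groebner basis\<close>

locale ci_order = ci n k m + mon_order n r for n k m r +
  assumes variable_order: "1 \<le> i \<Longrightarrow> i < j \<Longrightarrow> j \<le> n \<Longrightarrow> (single j 1, single i 1) \<in> r"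
begin

text \<open>After cancelling the common factor \<open>u\<close>, a monomial \<open>y\<close> in
  \<open>x_j, ..., x_n\<close> is compared with \<open>z\<close> in \<open>x_1, ..., x_j\<close> of
  the same degree, so \<open>mdeg_eq_le\<close> applies.\<close>

lemma keys_g_poly_le:
  assumes j: "j \<in> {1..n}" and s: "s \<in> crit n m k j"
    and t: "t \<in> keys (g_poly n m j s :: ('a::field_char_0) mpol)"
  shows "(t, s) \<in> r"
proof -
  let ?s' = "trunc (j - 1) s"
  obtain u y where uy: "t = u + y" "mdvd u ?s'" "keys y \<subseteq> {j..n}" "mdeg y = mdeg s - mdeg u"
    using keys_g_poly[OF j t] by blast
  have sj: "s \<in> monomials j"
    using s unfolding crit_iff[OF j] by blast
  have "mdvd u s"
    using uy(2) trunc_mdvd mdvd_trans by blast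
  then obtain z where z: "s = u + z"
    by (auto simp: mdvd_def)
  have z_mon: "z \<in> monomials j"
    using mdvd_monomials[OF _ sj, of z] mdvd_add[of z u] z by (simp add: add.commute)
  have mons: "y \<in> monomials n" "z \<in> monomials n" "u \<in> monomials n"
    using uy(3) j z_mon monomials_mono[of j n] mdvd_monomials[OF \<open>mdvd u s\<close> sj] by (force simp: monomials_def)+
  have vars: "(single a 1, single b 1) \<in> r" if "a \<in> keys y" "b \<in> keys z" for a b
  proof -
    have "j \<le> a" "a \<le> n" "1 \<le> b" "b \<le> j"
      using that uy(3) z_mon by (auto simp: monomials_def)
    then show ?thesis
      using variable_order[of b a] le_refl[OF single_in_monomials[of a n]] by (cases "a = b") auto
  qed
  have "(y, z) \<in> r"
  proof (rule mdeg_eq_le)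
    show "mdeg y = mdeg z"
      using uy(4) z by (simp add: mdeg_add)
  qed (fact vars mons)+
  then have "(y + u, z + u) \<in> r"
    using mons(3) by (rule le_add)
  then show ?thesis
    by (simp add: uy(1) z add.commute)
qed

lemma initial_monomial_g_poly:
  assumes "j \<in> {1..n}" "s \<in> crit n m k j"
  shows "initial_monomial r (g_poly n m j s :: ('a::field_char_0) mpol) = s"
  using assms lookup_g_poly_crit[OF assms, where 'a = 'a] keys_g_poly_le[OF assms, where 'a = 'a]
  by (intro initial_monomial_eqI) (auto simp: in_keys_iff)

lemma initial_monomial_X_power:
  "j \<in> {1..n} \<Longrightarrow> initial_monomial r (X j ^ e :: ('a::comm_ring_1) mpol) = single j e"
  unfolding X_power by (intro initial_monomial_eqI) (auto intro!: le_refl single_in_monomials)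

text \<open>A standard initial monomial would, together with all nonstandard monomials of its
  degree, give \<open>card ?S + 1\<close> independent vectors in a space spanned by at most
  \<open>card ?U\<close> vectors, while \<open>card ?U <= card ?S\<close>.\<close>

lemma initial_monomial_not_standard:
  assumes p: "p \<in> (ideal_I n m k :: ('a::field_char_0) mpol set)" "p \<noteq> 0"
  shows "\<not> standard (initial_monomial r p)" (is "\<not> standard ?t")
proof
  assume std: "standard ?t"
  let ?I = "ideal_I n m k :: 'a mpol set"
  let ?d = "mdeg ?t"
  let ?S = "{s \<in> m_free_mons n m ?d. \<not> standard s}"
  let ?U = "{u \<in> monomials n. m_free n m u \<and> mdeg u + k = ?d}"
  have kp: "keys p \<subseteq> monomials n"
    using p ideal_ideal_I unfolding ideal_poly_ring_iff carrier_poly_ring[symmetric] by blast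
  have t: "?t \<in> m_free_mons n m ?d"
    using std by (simp add: standard_def m_free_mons_def)
  \<comment> \<open>A nonstandard \<open>v\<close> is the initial monomial of a monomial multiple of
    some \<open>g_c\<close> with \<open>c\<close> critical; \<open>?t\<close> is that of
    \<open>p\<close>.\<close>
  have "\<exists>h\<in>?I. v \<in> keys h \<and> (\<forall>u\<in>keys h. (u, v) \<in> r)" if v: "v \<in> insert ?t ?S" for v
  proof (cases "v = ?t")
    case True
    then show ?thesis
      using p kp initial_monomial by blast
  next
    case False
    with v have v: "v \<in> monomials n" "m_free n m v" "\<not> standard v"
      by (auto simp: m_free_mons_def)
    then obtain j c where c: "j \<in> {1..n}" "c \<in> crit n m k j" "mdvd c v"
      by (rule nonstandard_crit_divisor)
    then obtain w where w: "v = w + c"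
      by (auto simp: mdvd_def add.commute)
    have w_mon: "w \<in> monomials n"
      using v(1) mdvd_monomials mdvd_add unfolding w by blast
    let ?h = "single w 1 * g_poly n m j c :: 'a mpol"
    have "?h \<in> ?I"
      using w_mon by (intro ideal_mult_closed[OF ideal_ideal_I] g_poly_in_ideal_I c) simp
    moreover have "v \<in> keys ?h"
      unfolding in_keys_iff w lookup_single_mult using lookup_g_poly_crit[OF c(1,2), where 'a = 'a] by simp
    moreover have "(u, v) \<in> r" if u: "u \<in> keys ?h" for u
    proof -
      obtain x where x: "u = w + x" "x \<in> keys (g_poly n m j c :: 'a mpol)"
        using u keys_single_mult by blast
      have "(x + w, c + w) \<in> r"
        by (intro le_add keys_g_poly_le[OF c(1,2) x(2)] w_mon)
      then show ?thesis
        by (simp add: x w add.commute)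
    qed
    ultimately show ?thesis
      by blast
  qed
  then have "\<exists>h. \<forall>v\<in>insert ?t ?S. h v \<in> ?I \<and> v \<in> keys (h v) \<and> (\<forall>u\<in>keys (h v). (u, v) \<in> r)"
    by (intro bchoice) blast
  then obtain h where h: "\<And>v. v \<in> insert ?t ?S \<Longrightarrow> h v \<in> ?I"
    "\<And>v. v \<in> insert ?t ?S \<Longrightarrow> v \<in> keys (h v)"
    "\<And>u v. v \<in> insert ?t ?S \<Longrightarrow> u \<in> keys (h v) \<Longrightarrow> (u, v) \<in> r"
    by blast
  define f where "f v = proj n m ?d (h v)" for v
  have fin: "finite ?S" "finite ?U"
    using finite_m_free_mons finite_subset[OF _ finite_m_free[of n m], of ?U] by auto
  have B: "finite (insert ?t ?S)" "insert ?t ?S \<subseteq> m_free_mons n m ?d"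
    using fin t by auto
  have Bm: "insert ?t ?S \<subseteq> monomials n"
    using B(2) by (auto simp: m_free_mons_def)
  \<comment> \<open>The projection only removes monomials and keeps \<open>v\<close>, which is
    \<open>m\<close>-free of the chosen degree.\<close>
  have f: "v \<in> keys (f v)" "u \<in> keys (f v) \<Longrightarrow> (u, v) \<in> r" if "v \<in> insert ?t ?S" for u v
  proof -
    have "v \<in> m_free_mons n m ?d"
      using B(2) that by blast
    then show "v \<in> keys (f v)"
      using h(2)[OF that] by (simp add: f_def in_keys_iff lookup_proj)
    show "u \<in> keys (f v) \<Longrightarrow> (u, v) \<in> r"
      using h(3)[OF that, of u] by (simp add: f_def in_keys_iff lookup_proj split: if_splits)
  qed
  let ?g = "\<lambda>u. proj n m ?d (single u 1 * (\<Sum>i=1..n. X i) ^ k) :: 'a mpol"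
  have "f ` insert ?t ?S \<subseteq> mpol.span (?g ` ?U)"
    unfolding f_def using proj_ideal_I_in_span[OF h(1)] by blast
  then have "card (f ` insert ?t ?S) \<le> card (?g ` ?U)"
    using mpol.independent_span_bound[OF finite_imageI[OF fin(2)] independent_distinct_initial(2)[OF B(1) Bm f]]
    by blast
  also have "\<dots> \<le> card ?U"
    using fin(2) by (rule card_image_le)
  also have "\<dots> \<le> card ?S"
    by (rule card_nonstandard_ge[OF standard_end_level[OF std]])
  also have "\<dots> < card (insert ?t ?S)"
    using fin(1) std by simp
  also have "\<dots> = card (f ` insert ?t ?S)"
    by (rule card_image[OF independent_distinct_initial(1)[OF B(1) Bm f], symmetric])
  finally show False
    by simp
qed

text \<open>In this case a smaller power of \<open>x_i\<close> is already critical, which is why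
  \<open>X i ^ m i\<close> is removed from the basis.\<close>

lemma pure_power_crit:
  assumes i: "i \<in> {1..n}" and lt: "k + (\<Sum>l=1..<i. m l - 1) < m i"
  shows "single i (k + (\<Sum>l=1..<i. m l - 1)) \<in> crit n m k i" (is "single i ?K \<in> _")
  unfolding crit_iff[OF i]
proof (intro conjI ballI)
  show "single i ?K \<in> monomials i"
    using i by (intro single_in_monomials) auto
  show "m_free n m (single i ?K)"
    unfolding m_free_def using lt m_ge_2 by (force simp: lookup_single when_def)
  show "1 \<le> lookup (single i ?K) i"
    using k_pos by simp
  have lower: "(\<Sum>l=1..<j. int (lookup (single i ?K) l)) = 0" if "j \<le> i" for j
    using that by (intro sum.neutral) (auto simp: lookup_single when_def)
  show "height i (single i ?K) = 0"
    using lower[of i] int_sum_m[of i] i by (simp add: height_def)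
  fix l assume l: "l \<in> {1..<i}"
  then have "int (\<Sum>a=1..<l. m a - 1) = (\<Sum>a=1..<l. int (m a) - 1)"
    using i by (intro int_sum_m) auto
  then have "(\<Sum>a=1..<l. int (m a) - 1) \<ge> 0"
    by linarith
  then show "height l (single i ?K) < 0"
    using l lower[of l] k_pos by (simp add: height_def lookup_single when_def)
qed

lemma reduced_groebner_basis_G:
  "reduced_groebner_basis n r (ideal_I n m k) (basis_G n m k :: ('a::field_char_0) mpol set)"
proof -
  let ?I = "ideal_I n m k :: 'a mpol set"
  let ?G = "basis_G n m k :: 'a mpol set"
  let ?in = "initial_monomial r :: 'a mpol \<Rightarrow> mon"
  let ?K = "\<lambda>j. k + (\<Sum>i=1..<j. m i - 1)"
  have I: "ideal ?I (poly_ring n)"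
    by (rule ideal_ideal_I)
  then have sub: "?I \<subseteq> carrier (poly_ring n)"
    unfolding ideal_poly_ring_iff by blast
  have G_X: "X j ^ m j \<in> ?G" if "j \<in> {1..n}" "\<not> ?K j < m j" for j
    using that unfolding basis_G_def by blast
  have G_g: "g_poly n m j s \<in> ?G" if "j \<in> {1..n}" "s \<in> crit n m k j" for j s
    using that unfolding basis_G_def by blast
  have G_cases: "(\<exists>j\<in>{1..n}. \<not> ?K j < m j \<and> g = X j ^ m j \<and> ?in g = single j (m j)) \<or>
      (\<exists>j\<in>{1..n}. \<exists>s\<in>crit n m k j. g = g_poly n m j s \<and> ?in g = s)" if "g \<in> ?G" for g
    using that initial_monomial_X_power initial_monomial_g_poly unfolding basis_G_def by blast
  have fin: "finite ?G"
  proof -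
    have "finite (crit n m k j)" if "j \<in> {1..n}" for j
    proof (rule finite_subset[OF _ finite_m_free[of n m]])
      show "crit n m k j \<subseteq> {s \<in> monomials n. m_free n m s}"
        by (auto simp: crit_def crit_bar_def)
    qed
    then show ?thesis
      unfolding basis_G_def by (simp add: setcompr_eq_image)
  qed
  have G_I: "?G \<subseteq> ?I"
    unfolding basis_G_def using X_power_in_ideal_I g_poly_in_ideal_I by blast
  have lead: "lookup g (?in g) = 1" if "g \<in> ?G" for g
    using G_cases[OF that]
  proof (elim disjE bexE conjE)
    fix j assume "g = X j ^ m j" "?in g = single j (m j)"
    then show ?thesis
      by (simp add: X_power mon_poly_def)
  next
    fix j s assume s: "j \<in> {1..n}" "s \<in> crit n m k j" "g = g_poly n m j s" "?in g = s"
    show ?thesis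
      unfolding s(4) unfolding s(3) by (rule lookup_g_poly_crit[OF s(1,2)])
  qed
  then have G_0: "0 \<notin> ?G"
    by force
  \<comment> \<open>An \<open>m\<close>-free initial monomial is nonstandard and has a critical
    divisor; any other is divisible by some power \<open>x_i^(m i)\<close>.\<close>
  have divisor: "\<exists>g\<in>?G. mdvd (?in g) (?in p)" if p: "p \<in> ?I" "p \<noteq> 0" for p
  proof (cases "m_free n m (?in p)")
    case True
    have "?in p \<in> monomials n"
      using initial_monomial_in_monomials[of p "{p}"] p sub by auto
    from this True initial_monomial_not_standard[OF p]
    obtain j s where s: "j \<in> {1..n}" "s \<in> crit n m k j" "mdvd s (?in p)"
      by (rule nonstandard_crit_divisor)
    then show ?thesis
      by (intro bexI[OF _ G_g[OF s(1,2)]]) (simp only: initial_monomial_g_poly[OF s(1,2)])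
  next
    case False
    then obtain i where i: "i \<in> {1..n}" "m i \<le> lookup (?in p) i"
      by (auto simp: m_free_def not_less)
    \<comment> \<open>If \<open>X i ^ m i\<close> was removed from the basis, the critical power of
      \<open>x_i\<close> serves as the divisor.\<close>
    show ?thesis
    proof (cases "?K i < m i")
      case True
      then have "single i (?K i) \<in> crit n m k i"
        by (intro pure_power_crit i)
      then show ?thesis
        using i True
        by (intro bexI[OF _ G_g[of i "single i (?K i)"]]) (simp_all add: initial_monomial_g_poly single_mdvd_iff)
    next
      case False
      then show ?thesis
        using i by (intro bexI[OF _ G_X[of i]]) (simp_all add: initial_monomial_X_power single_mdvd_iff)
    qed
  qed
  have X_crit: "\<not> mdvd (single i (m i)) s" if "i \<in> {1..n}" "m_free n m s" for i s
    using that by (auto simp: single_mdvd_iff m_free_def not_le)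
  have crit_free: "m_free n m s" if "s \<in> crit n m k j" for j s
    using that by (simp add: crit_def crit_bar_def)
  \<comment> \<open>A critical divisor of a power of \<open>x_j\<close> is itself the power with
    exponent \<open>?K j\<close>; being \<open>m\<close>-free it forces
    \<open>?K j < m j\<close>.\<close>
  have crit_X: "\<not> mdvd s (single j (m j))" if ij: "i \<in> {1..n}" "j \<in> {1..n}" "s \<in> crit n m k i" "\<not> ?K j < m j" for i j s
  proof
    assume dvd: "mdvd s (single j (m j))"
    have s: "lookup s i \<ge> 1" "height i s = 0" "lookup s i < m i"
      using ij(1,3) crit_free[OF ij(3)] unfolding crit_iff[OF ij(1)] by (auto simp: m_free_def)
    have s0: "lookup s l = 0" if "l \<noteq> j" for l
      using dvd that by (auto simp: mdvd_iff lookup_single when_def dest: spec[of _ l])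
    then have "i = j"
      using s(1) by force
    moreover have "(\<Sum>l=1..<j. int (lookup s l)) = 0"
      using s0 by (intro sum.neutral) auto
    ultimately have "int (lookup s j) = int (?K j)"
      using s(2) int_sum_m[of j] ij(2) by (simp add: height_def)
    then have "lookup s j = ?K j"
      by (simp only: of_nat_eq_iff)
    then show False
      using ij(4) s(3) \<open>i = j\<close> by simp
  qed
  have minimal: "g = h" if gh: "g \<in> ?G" "h \<in> ?G" "mdvd (?in g) (?in h)" for g h
    using G_cases[OF gh(1)]
  proof (elim disjE bexE conjE)
    fix i assume g: "i \<in> {1..n}" "g = X i ^ m i" "?in g = single i (m i)"
    from G_cases[OF gh(2)] show ?thesis
    proof (elim disjE bexE conjE)
      fix j assume h: "j \<in> {1..n}" "h = X j ^ m j" "?in h = single j (m j)"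
      have "m i \<le> lookup (single j (m j)) i"
        using gh(3) by (simp add: g(3) h(3) single_mdvd_iff)
      then have "i = j"
        using m_ge_2[OF g(1)] by (auto simp: lookup_single when_def split: if_splits)
      then show ?thesis
        by (simp add: g h)
    next
      fix j s assume "s \<in> crit n m k j" "?in h = s"
      then show ?thesis
        using gh(3) X_crit[OF g(1) crit_free] by (simp add: g(3))
    qed
  next
    fix i s assume g: "i \<in> {1..n}" "s \<in> crit n m k i" "g = g_poly n m i s" "?in g = s"
    from G_cases[OF gh(2)] show ?thesis
    proof (elim disjE bexE conjE)
      fix j assume "j \<in> {1..n}" "\<not> ?K j < m j" "?in h = single j (m j)"
      then show ?thesis
        using gh(3) crit_X[OF g(1) _ g(2)] by (simp add: g(4))
    next
      fix j t assume h: "j \<in> {1..n}" "t \<in> crit n m k j" "h = g_poly n m j t" "?in h = t"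
      have "mdvd s t"
        using gh(3) unfolding g(4) h(4) .
      from crit_mdvd_crit[OF g(1) h(1) g(2) h(2) this] show ?thesis
        unfolding g(3) h(3) by simp
    qed
  qed
  have reduced: "\<not> mdvd (?in h) t" if g: "g \<in> ?G" "t \<in> keys g" "t \<noteq> ?in g" and h: "h \<in> ?G" for g h t
  proof -
    \<comment> \<open>A pure power has no monomial besides its leading one, so \<open>t\<close>
      comes from some \<open>g_s\<close>.\<close>
    have std: "standard t"
      using G_cases[OF g(1)] g(2,3) keys_g_poly_standard[where 'a = 'a] by (auto simp: X_power)
    then have "m_free n m t"
      by (simp add: standard_def)
    with std G_cases[OF h] show ?thesis
      using X_crit crit_not_mdvd_standard by (elim disjE bexE conjE) simp_all
  qed
  show ?thesis
    unfolding reduced_groebner_basis_iff[OF sub]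
    using fin G_I G_0 divisor minimal lead reduced by blast
qed

end

theorem theorem1p1:
  fixes n k :: nat and m :: "nat \<Rightarrow> nat" and r :: "mon rel"
    and H :: "('a::field_char_0) mpol set"
  assumes "n \<ge> 1" and "k \<ge> 1"
    and "\<forall>i\<in>{1..n}. m i \<ge> 2"
    and "monomial_ordering n r"
    and "\<forall>i j. 1 \<le> i \<and> i < j \<and> j \<le> n \<longrightarrow> (Poly_Mapping.single j 1, Poly_Mapping.single i 1) \<in> r"
  shows "reduced_groebner_basis n r (ideal_I n m k) H \<longleftrightarrow> H = basis_G n m k"
proof -
  interpret ci_order n k m r
    using assms by unfold_locales auto
  show ?thesis
    by (rule reduced_groebner_basis_unique[OF ideal_ideal_I reduced_groebner_basis_G])
qed

end
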